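(* Let $\Gamma$ be a normalized bridgeless metrized graph with $v=\#V(\Gamma)$ vertices, genus $g$ and edge connectivity $\Lambda(\Gamma)$, and let $x=x(\Gamma)$, $y=y(\Gamma)$ (defined with respect to a fixed vertex $p$). Then: (1) $\tau(\Gamma)=\frac1{12}-\frac x6+\frac y6$; (2) $1\ge \frac{\Lambda(\Gamma)+v-1}{v-1}\,x+y$, $x\ge0$ and $y\ge0$; (3) $y\ge\frac{v+6}{4v}(x+y)^2$; (4) $g\cdot y\ge x\ge(\Lambda(\Gamma)-1)\,y$.
   Context: A metrized graph is a finite connected graph (multiple edges and self-loops allowed) whose edges $e_i$ are identified with closed segments of lengths $L_i>0$; its vertex set $V(\Gamma)$ is finite, nonempty and contains all points of valence $\neq2$; $e=\#E(\Gamma)$, $v=\#V(\Gamma)$, genus $g=e-v+1$, total length $\ell(\Gamma)=\sum L_i$; $\Gamma$ is normalized if $\ell(\Gamma)=1$. $\Gamma$ is bridgeless if removing the interior of any edge leaves it connected. $\Lambda(\Gamma)$ is the minimum number of edges whose deletion disconnects $\Gamma$. View $\Gamma$ as an electric circuit with edge resistances equal to lengths; $r(x,y)$ is effective resistance and the voltage function $j_z(x,y)$ is the voltage at $x$ (with reference voltage $0$ at $z$) when unit current enters at $y$ and exits at $z$. The tau constant is $\tau(\Gamma)=\frac14\int_\Gamma(\frac{\partial}{\partial x}r(x,y))^2dx$ (independent of $y$). For an edge $e_i$ with endpoints $p_i,q_i$, $\Gamma-e_i$ is $\Gamma$ with the interior of $e_i$ removed, $R_i$ is the effective resistance between $p_i,q_i$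 in $\Gamma-e_i$, and for the fixed vertex $p$, with $\hat j$ the voltage function of $\Gamma-e_i$, $R_{a_i,p}=\hat j_{p_i}(p,q_i)$, $R_{b_i,p}=\hat j_{q_i}(p_i,p)$ (so $R_{a_i,p}+R_{b_i,p}=R_i$). Then $y(\Gamma)=\frac14\sum_{e_i}\frac{L_iR_i^2}{(L_i+R_i)^2}+\frac34\sum_{e_i}\frac{L_i(R_{a_i,p}-R_{b_i,p})^2}{(L_i+R_i)^2}$ and $x(\Gamma)=\sum_{e_i}\frac{L_i^2R_i}{(L_i+R_i)^2}+\frac34\sum_{e_i}\frac{L_iR_i^2}{(L_i+R_i)^2}-\frac34\sum_{e_i}\frac{L_i(R_{a_i,p}-R_{b_i,p})^2}{(L_i+R_i)^2}$. *)

theory Defs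
  imports "HOL-Analysis.Analysis" "Graph_Theory.Digraph_Component"
begin

hide_const (open) Topological_Spaces.connected

text \<open>
  A metrized graph is a finite connected multigraph (loops and parallel edges allowed) whose
  edge \<open>e\<close> is the segment \<open>[0, L e]\<close>.  The orientation given by \<open>tail\<close> and \<open>head\<close> only
  serves to parametrize the edges: \<open>0\<close> is the tail end and \<open>L e\<close> the head end.
  \<open>Digraph_Component.connected\<close> is connectedness of the underlying undirected graph and includes
  that \<open>verts G\<close> is nonempty.  Interior points of edges have valence 2, so all points of valence
  different from 2 are in the vertex set automatically.
\<close>

locale metrized_graph = fin_digraph G
  for G :: "('v, 'e) pre_digraph" (structure) +
  fixes L :: "'e \<Rightarrow> real"
  assumes connected_graph: "Digraph_Component.connected G"
    and length_pos: "e \<in> arcs G \<Longrightarrow> 0 < L e"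

definition total_length :: "('v, 'e) pre_digraph \<Rightarrow> ('e \<Rightarrow> real) \<Rightarrow> real" where
  "total_length G L = (\<Sum>e\<in>arcs G. L e)"

definition normalized :: "('v, 'e) pre_digraph \<Rightarrow> ('e \<Rightarrow> real) \<Rightarrow> bool" where
  "normalized G L \<longleftrightarrow> total_length G L = 1"

definition genus :: "('v, 'e) pre_digraph \<Rightarrow> int" where
  "genus G = int (card (arcs G)) - int (card (verts G)) + 1"

definition del_arcs :: "('v, 'e) pre_digraph \<Rightarrow> 'e set \<Rightarrow> ('v, 'e) pre_digraph" where
  "del_arcs G F = \<lparr>verts = verts G, arcs = arcs G - F, tail = tail G, head = head G\<rparr>"

definition bridgeless :: "('v, 'e) pre_digraph \<Rightarrow> bool" where
  "bridgeless G \<longleftrightarrow> (\<forall>e\<in>arcs G. Digraph_Component.connected (pre_digraph.del_arc G e))"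

text \<open>
  With a single vertex no deletion of edges disconnects the graph; the infimum over the empty
  set of natural numbers is then 0.
\<close>

definition edge_connectivity :: "('v, 'e) pre_digraph \<Rightarrow> nat" where
  "edge_connectivity G =
     Inf {card F | F. F \<subseteq> arcs G \<and> \<not> Digraph_Component.connected (del_arcs G F)}"

text \<open>
  Electric circuits: the edge \<open>e\<close> is a resistor of resistance \<open>L e\<close>.  By Ohm's law the current
  leaving \<open>u\<close> through \<open>e\<close> is the voltage drop divided by \<open>L e\<close>; a loop contributes 0.
\<close>

definition current_out ::
  "('n, 'k) pre_digraph \<Rightarrow> ('k \<Rightarrow> real) \<Rightarrow> ('n \<Rightarrow> real) \<Rightarrow> 'n \<Rightarrow> real" where
  "current_out G L f u =
     (\<Sum>e\<in>out_arcs G u. (f u - f (head G e)) / L e) + (\<Sum>e\<in>in_arcs G u. (f u - f (tail G e)) / L e)"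

text \<open>Kirchhoff's law when unit current enters at \<open>y\<close> and exits at \<open>z\<close>, with \<open>z\<close> grounded.\<close>

definition is_potential ::
  "('n, 'k) pre_digraph \<Rightarrow> ('k \<Rightarrow> real) \<Rightarrow> 'n \<Rightarrow> 'n \<Rightarrow> ('n \<Rightarrow> real) \<Rightarrow> bool" where
  "is_potential G L y z f \<longleftrightarrow>
     (\<forall>u\<in>verts G. current_out G L f u = (if u = y then 1 else 0) - (if u = z then 1 else 0))
     \<and> f z = 0"

text \<open>
  \<open>voltage G L z x y\<close> is the voltage function \<open>j_z(x, y)\<close> for vertices \<open>x, y, z\<close>.  The potential
  is unique on the vertices of a connected graph, but arbitrary elsewhere, hence the description
  of its value at \<open>x\<close> rather than of the potential.
\<close>

definition voltage ::
  "('n, 'k) pre_digraph \<Rightarrow> ('k \<Rightarrow> real) \<Rightarrow> 'n \<Rightarrow> 'n \<Rightarrow> 'n \<Rightarrow> real" where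
  "voltage G L z x y = (THE a. \<exists>f. is_potential G L y z f \<and> a = f x)"

definition effective_resistance ::
  "('n, 'k) pre_digraph \<Rightarrow> ('k \<Rightarrow> real) \<Rightarrow> 'n \<Rightarrow> 'n \<Rightarrow> real" where
  "effective_resistance G L x y = voltage G L y x x"

text \<open>
  The points of the metrized graph: \<open>Inner e t\<close> is the point of the edge \<open>e\<close> at distance \<open>t\<close> from
  its tail end, where \<open>0 < t < L e\<close>.
\<close>

datatype ('v, 'e) point = Vertex 'v | Inner 'e real

definition points :: "('v, 'e) pre_digraph \<Rightarrow> ('e \<Rightarrow> real) \<Rightarrow> ('v, 'e) point set" where
  "points G L = Vertex ` verts G \<union> {Inner e t | e t. e \<in> arcs G \<and> 0 < t \<and> t < L e}"

definition edge_point ::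
  "('v, 'e) pre_digraph \<Rightarrow> ('e \<Rightarrow> real) \<Rightarrow> 'e \<Rightarrow> real \<Rightarrow> ('v, 'e) point" where
  "edge_point G L e t =
     (if t = 0 then Vertex (tail G e) else if t = L e then Vertex (head G e) else Inner e t)"

text \<open>
  Arbitrary points become nodes of a circuit by adding them to the vertex set.  The arc
  \<open>(e, s, t)\<close> of the subdivision is the piece \<open>[s, t]\<close> of \<open>e\<close> between consecutive division points.
\<close>

definition division_points :: "('e \<Rightarrow> real) \<Rightarrow> ('v, 'e) point set \<Rightarrow> 'e \<Rightarrow> real set" where
  "division_points L S e = {0, L e} \<union> {t. Inner e t \<in> S}"

definition subdivision_at ::
  "('v, 'e) pre_digraph \<Rightarrow> ('e \<Rightarrow> real) \<Rightarrow> ('v, 'e) point set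
     \<Rightarrow> (('v, 'e) point, 'e \<times> real \<times> real) pre_digraph" where
  "subdivision_at G L S =
     \<lparr>verts = Vertex ` verts G \<union> S,
      arcs = {(e, s, t). e \<in> arcs G \<and> s \<in> division_points L S e \<and> t \<in> division_points L S e
                \<and> s < t \<and> (\<forall>u\<in>division_points L S e. \<not> (s < u \<and> u < t))},
      tail = (\<lambda>(e, s, t). edge_point G L e s),
      head = (\<lambda>(e, s, t). edge_point G L e t)\<rparr>"

definition segment_length :: "'e \<times> real \<times> real \<Rightarrow> real" where
  "segment_length = (\<lambda>(e, s, t). t - s)"

definition resistance ::
  "('v, 'e) pre_digraph \<Rightarrow> ('e \<Rightarrow> real) \<Rightarrow> ('v, 'e) point \<Rightarrow> ('v, 'e) point \<Rightarrow> real" where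
  "resistance G L x y = effective_resistance (subdivision_at G L {x, y}) segment_length x y"

text \<open>
  The tau constant, computed with base point \<open>y\<close>.  The integral over the metrized graph is the sum
  of the integrals over its edges, parametrized by arc length; the finitely many points where the
  derivative does not exist are negligible.
\<close>

definition tau ::
  "('v, 'e) pre_digraph \<Rightarrow> ('e \<Rightarrow> real) \<Rightarrow> ('v, 'e) point \<Rightarrow> real" where
  "tau G L y =
     1/4 * (\<Sum>e\<in>arcs G. integral {0..L e}
       (\<lambda>t. (deriv (\<lambda>s. resistance G L (edge_point G L e s) y) t)\<^sup>2))"

text \<open>
  For an edge \<open>e\<close>, the resistance \<open>R\<^sub>e\<close> of the rest of the graph between the end points of \<open>e\<close>,
  and the resistances \<open>R\<^sub>a\<close>, \<open>R\<^sub>b\<close> with respect to the vertex \<open>p\<close>.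
\<close>

definition edge_R :: "('v, 'e) pre_digraph \<Rightarrow> ('e \<Rightarrow> real) \<Rightarrow> 'e \<Rightarrow> real" where
  "edge_R G L e = effective_resistance (pre_digraph.del_arc G e) L (tail G e) (head G e)"

definition edge_Ra :: "('v, 'e) pre_digraph \<Rightarrow> ('e \<Rightarrow> real) \<Rightarrow> 'v \<Rightarrow> 'e \<Rightarrow> real" where
  "edge_Ra G L p e = voltage (pre_digraph.del_arc G e) L (tail G e) p (head G e)"

definition edge_Rb :: "('v, 'e) pre_digraph \<Rightarrow> ('e \<Rightarrow> real) \<Rightarrow> 'v \<Rightarrow> 'e \<Rightarrow> real" where
  "edge_Rb G L p e = voltage (pre_digraph.del_arc G e) L (head G e) (tail G e) p"

definition y_invariant :: "('v, 'e) pre_digraph \<Rightarrow> ('e \<Rightarrow> real) \<Rightarrow> 'v \<Rightarrow> real" where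
  "y_invariant G L p =
     1/4 * (\<Sum>e\<in>arcs G. L e * (edge_R G L e)\<^sup>2 / (L e + edge_R G L e)\<^sup>2)
     + 3/4 * (\<Sum>e\<in>arcs G. L e * (edge_Ra G L p e - edge_Rb G L p e)\<^sup>2 / (L e + edge_R G L e)\<^sup>2)"

definition x_invariant :: "('v, 'e) pre_digraph \<Rightarrow> ('e \<Rightarrow> real) \<Rightarrow> 'v \<Rightarrow> real" where
  "x_invariant G L p =
     (\<Sum>e\<in>arcs G. (L e)\<^sup>2 * edge_R G L e / (L e + edge_R G L e)\<^sup>2)
     + 3/4 * (\<Sum>e\<in>arcs G. L e * (edge_R G L e)\<^sup>2 / (L e + edge_R G L e)\<^sup>2)
     - 3/4 * (\<Sum>e\<in>arcs G. L e * (edge_Ra G L p e - edge_Rb G L p e)\<^sup>2 / (L e + edge_R G L e)\<^sup>2)"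

end

theory Submission
  imports Defs
begin

text \<open>
  Fix the Green function \<open>g\<close> of the Laplacian grounded at \<open>p\<close>, characterized by the weak form
  \<open>E(g(\<cdot>, w), h) = h(w) - h(p)\<close> of Kirchhoff's law, where \<open>E\<close> is the Dirichlet energy.  All
  quantities are expressed through \<open>g\<close>: if \<open>\<alpha>\<close>, \<open>\<beta>\<close> are minus the value at the tail and the value
  at the head of the potential \<open>g \<chi>\<^sub>e\<close> of a unit current through the arc \<open>e\<close>, then
  \<open>\<alpha> + \<beta> = r\<^sub>e = L\<^sub>e R\<^sub>e / (L\<^sub>e + R\<^sub>e)\<close>, \<open>y = \<Sum>\<^sub>e (\<alpha>\<^sup>2 - \<alpha>\<beta> + \<beta>\<^sup>2) / L\<^sub>e\<close> and \<open>x + y = \<Sum>\<^sub>e r\<^sub>e\<close>.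

  Contracting \<open>e\<close> replaces \<open>g\<close> by \<open>g - (g \<chi>\<^sub>e)(g \<chi>\<^sub>e)\<^sup>T / r\<^sub>e\<close>.  With the weights \<open>r\<^sub>e / L\<^sub>e\<close>, which sum
  to \<open>v - 1\<close> (Foster), the values of \<open>x\<close> and \<open>y\<close> on the contracted graphs add up to \<open>v - 2\<close>
  times their values on the graph.  As contraction preserves the genus and does not decrease the
  edge connectivity, the inequalities (2) and (4) follow by induction from the graphs with two
  vertices.  Inequality (3) is obtained by averaging over the base point and Cauchy-Schwarz.  For
  (1), \<open>g\<close> is extended to all points of the metrized graph, which makes the resistance function
  explicit.
\<close>

section \<open>Electric networks and their Green functions\<close>

definition incr :: "('n, 'k) pre_digraph \<Rightarrow> ('n \<Rightarrow> real) \<Rightarrow> 'k \<Rightarrow> real" where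
  "incr G f e = f (head G e) - f (tail G e)"

text \<open>Reversing an arc changes the sign of both increments, so the form does not depend on the
  orientation; loops contribute nothing.\<close>

definition energy ::
  "('n, 'k) pre_digraph \<Rightarrow> ('k \<Rightarrow> real) \<Rightarrow> ('n \<Rightarrow> real) \<Rightarrow> ('n \<Rightarrow> real) \<Rightarrow> real" where
  "energy G L f h = (\<Sum>e\<in>arcs G. incr G f e * incr G h e / L e)"

lemma incr_add [simp]: "incr G (\<lambda>u. f u + h u) e = incr G f e + incr G h e"
  and incr_diff [simp]: "incr G (\<lambda>u. f u - h u) e = incr G f e - incr G h e"
  and incr_mult [simp]: "incr G (\<lambda>u. c * f u) e = c * incr G f e"
  and incr_const [simp]: "incr G (\<lambda>u. c) e = 0"
  by (simp_all add: incr_def algebra_simps)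

lemma energy_commute: "energy G L f h = energy G L h f"
  by (simp add: energy_def mult.commute)

lemma energy_add_left: "energy G L (\<lambda>u. f u + f' u) h = energy G L f h + energy G L f' h"
  by (simp add: energy_def sum.distrib [symmetric] add_divide_distrib distrib_right)

lemma energy_diff_left: "energy G L (\<lambda>u. f u - f' u) h = energy G L f h - energy G L f' h"
  by (simp add: energy_def sum_subtractf [symmetric] diff_divide_distrib left_diff_distrib)

lemma energy_mult_left: "energy G L (\<lambda>u. c * f u) h = c * energy G L f h"
  by (simp add: energy_def sum_distrib_left mult.assoc)

lemma energy_const_left [simp]: "energy G L (\<lambda>u. c) h = 0"
  by (simp add: energy_def)

lemma energy_diff_right: "energy G L h (\<lambda>u. f u - f' u) = energy G L h f - energy G L h f'"
  and energy_mult_right: "energy G L h (\<lambda>u. c * f u) = c * energy G L h f"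
  by (simp_all add: energy_diff_left energy_mult_left energy_commute [of G L h])

text \<open>Summation by parts: the contribution of each arc is split between its two end vertices
  and regrouped by vertex.\<close>

lemma (in fin_digraph) energy_current_out:
  "energy G L f h = (\<Sum>u\<in>verts G. h u * current_out G L f u)"
proof -
  have "(\<Sum>u\<in>verts G. h u * (\<Sum>e\<in>out_arcs G u. (f u - f (head G e)) / L e))
      = (\<Sum>u\<in>verts G. \<Sum>e\<in>{e \<in> arcs G. tail G e = u}. h (tail G e) * (f (tail G e) - f (head G e)) / L e)"
    by (auto simp: out_arcs_def sum_distrib_left intro!: sum.cong)
  also have "\<dots> = (\<Sum>e\<in>arcs G. h (tail G e) * (f (tail G e) - f (head G e)) / L e)"
    by (rule sum.group) auto
  finally have 1: "(\<Sum>u\<in>verts G. h u * (\<Sum>e\<in>out_arcs G u. (f u - f (head G e)) / L e)) = \<dots>" .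
  have "(\<Sum>u\<in>verts G. h u * (\<Sum>e\<in>in_arcs G u. (f u - f (tail G e)) / L e))
      = (\<Sum>u\<in>verts G. \<Sum>e\<in>{e \<in> arcs G. head G e = u}. h (head G e) * (f (head G e) - f (tail G e)) / L e)"
    by (auto simp: in_arcs_def sum_distrib_left intro!: sum.cong)
  also have "\<dots> = (\<Sum>e\<in>arcs G. h (head G e) * (f (head G e) - f (tail G e)) / L e)"
    by (rule sum.group) auto
  finally have 2: "(\<Sum>u\<in>verts G. h u * (\<Sum>e\<in>in_arcs G u. (f u - f (tail G e)) / L e)) = \<dots>" .
  show ?thesis
    unfolding energy_def incr_def current_out_def distrib_left sum.distrib 1 2
    unfolding sum.distrib [symmetric]
    by (intro sum.cong refl) (simp add: algebra_simps add_divide_distrib diff_divide_distrib)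
qed

text \<open>Weighting Kirchhoff's law by \<open>h\<close> and summing over the vertices gives the
  weak form; conversely, the indicator of \<open>u\<close> as test function isolates the current at
  \<open>u\<close>.\<close>

lemma (in fin_digraph) is_potential_iff_energy:
  assumes "y \<in> verts G" "z \<in> verts G"
  shows "is_potential G L y z f \<longleftrightarrow> (\<forall>h. energy G L f h = h y - h z) \<and> f z = 0"
proof -
  have "energy G L f h = h y - h z"
    if "\<And>u. u \<in> verts G \<Longrightarrow> current_out G L f u = (if u = y then 1 else 0) - (if u = z then 1 else 0)" for h
  proof -
    have "energy G L f h = (\<Sum>u\<in>verts G. h u * ((if u = y then 1 else 0) - (if u = z then 1 else 0)))"
      unfolding energy_current_out using that by (intro sum.cong) auto
    also have "\<dots> = h y - h z"
    proof -
      have "(\<Sum>u\<in>verts G. h u * (if u = x then 1 else 0)) = h x" if "x \<in> verts G" for x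
        using that by (subst sum.remove [of _ x]) (auto intro!: sum.neutral)
      then show ?thesis using assms by (simp only: right_diff_distrib sum_subtractf)
    qed
    finally show ?thesis .
  qed
  moreover have "current_out G L f u = (if u = y then 1 else 0) - (if u = z then 1 else 0)"
    if "\<And>h. energy G L f h = h y - h z" "u \<in> verts G" for u
  proof -
    have "energy G L f (\<lambda>w. if w = u then 1 else 0)
        = (\<Sum>w\<in>verts G. if w = u then current_out G L f w else 0)"
      unfolding energy_current_out by (intro sum.cong) auto
    with that show ?thesis by (auto split: if_splits)
  qed
  ultimately show ?thesis unfolding is_potential_def by metis
qed

text \<open>Connectedness is encoded in the existence of \<open>g\<close>: the indicator of a
  component avoiding \<open>p\<close> would violate \<open>energy_green\<close>. To pass to a
  contracted or subdivided graph it therefore suffices to exhibit the new Green function.\<close>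

locale green_network = fin_digraph G
  for G :: "('n, 'k) pre_digraph" (structure) +
  fixes L :: "'k \<Rightarrow> real" and p :: 'n and g :: "'n \<Rightarrow> 'n \<Rightarrow> real"
  assumes length_pos: "e \<in> arcs G \<Longrightarrow> 0 < L e"
    and base_in_verts [simp]: "p \<in> verts G"
    and green_base [simp]: "w \<in> verts G \<Longrightarrow> g p w = 0"
    and energy_green: "w \<in> verts G \<Longrightarrow> energy G L (\<lambda>u. g u w) h = h w - h p"
begin

text \<open>\<open>g\<close> is the reproducing kernel of the energy on functions vanishing at
  \<open>p\<close>, and it inherits the symmetry of the energy.\<close>

lemma green_commute:
  assumes "u \<in> verts G" "w \<in> verts G"
  shows "g u w = g w u"
proof -
  have "g u w = energy G L (\<lambda>x. g x u) (\<lambda>x. g x w)" by (simp add: energy_green assms)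
  also have "\<dots> = g w u" by (subst energy_commute) (simp add: energy_green assms)
  finally show ?thesis .
qed

lemma energy_green_diff:
  assumes "y \<in> verts G" "z \<in> verts G"
  shows "energy G L (\<lambda>u. g u y - g u z + c) h = h y - h z"
  using assms by (simp add: energy_add_left energy_diff_left energy_green)

text \<open>Uniqueness up to an additive constant: pairing the difference with the Green function of
  pole \<open>u\<close> evaluates it at \<open>u\<close> relative to \<open>p\<close>.\<close>

lemma energy_determines:
  assumes "\<And>h. energy G L f h = energy G L f' h" and "u \<in> verts G"
  shows "f u - f' u = f p - f' p"
  using energy_green [OF assms(2), of "\<lambda>u. f u - f' u"]
  by (simp add: energy_commute [of G L "\<lambda>x. g x u"] energy_diff_left assms(1))

lemma voltage_eq_potential:
  assumes "\<And>h. energy G L f h = h y - h z" and "f z = 0"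
    and "x \<in> verts G" "y \<in> verts G" "z \<in> verts G"
  shows "voltage G L z x y = f x"
proof -
  have f: "is_potential G L y z f"
    unfolding is_potential_iff_energy [OF assms(4,5)] using assms(1,2) by blast
  have "f' x = f x" if "is_potential G L y z f'" for f'
  proof -
    have f': "energy G L f' h = energy G L f h" "f' z = f z" for h
      using that assms(1,2) unfolding is_potential_iff_energy [OF assms(4,5)] by simp_all
    show ?thesis
      using energy_determines [OF f'(1) assms(3)] energy_determines [OF f'(1) assms(5)] f'(2) by simp
  qed
  with f show ?thesis unfolding voltage_def by (intro the_equality) blast+
qed

lemma voltage_eq_green:
  assumes "x \<in> verts G" "y \<in> verts G" "z \<in> verts G"
  shows "voltage G L z x y = g x y - g x z - g z y + g z z"
proof -
  have "voltage G L z x y = g x y - g x z + (g z z - g z y)"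
  proof (rule voltage_eq_potential)
    show "energy G L (\<lambda>x. g x y - g x z + (g z z - g z y)) h = h y - h z" for h
      using assms(2,3) by (rule energy_green_diff)
  qed (use assms in auto)
  then show ?thesis by simp
qed

lemma effective_resistance_eq_green:
  assumes "x \<in> verts G" "y \<in> verts G"
  shows "effective_resistance G L x y = g x x + g y y - 2 * g x y"
proof -
  have "g y x = g x y" using assms by (rule green_commute [rotated])
  then show ?thesis
    unfolding effective_resistance_def voltage_eq_green [OF assms(1) assms(1) assms(2)] by simp
qed

end

section \<open>Existence of the Green function\<close>

lemma connected_imp_constant:
  assumes "wf_digraph G" "Digraph_Component.connected G"
    and step: "\<And>e. e \<in> arcs G \<Longrightarrow> f (tail G e) = f (head G e)"
    and "u \<in> verts G" "w \<in> verts G"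
  shows "f u = f w"
proof -
  have "u \<rightarrow>\<^sup>*\<^bsub>with_proj (mk_symmetric G)\<^esub> w"
    using assms by (auto simp: connected_def strongly_connected_def)
  then have "(u, w) \<in> (arcs_ends (with_proj (mk_symmetric G)))\<^sup>*"
    by (rule reachable_rtranclI)
  then show ?thesis
  proof induction
    case (step y z)
    then have "(y, z) \<in> parcs (mk_symmetric G)" by simp
    then have "f y = f z" using assms(3) by (auto simp: parcs_mk_symmetric)
    with step.IH show ?case by simp
  qed simp
qed

text \<open>Gaussian elimination: one equation is solved for an unknown \<open>i0\<close> with
  nonzero coefficient, which is then substituted into the others.\<close>

lemma underdetermined_system:
  fixes A :: "'j \<Rightarrow> 'i \<Rightarrow> real"
  assumes "finite J" "finite I" "card J < card I"
  shows "\<exists>f. (\<exists>i\<in>I. f i \<noteq> 0) \<and> (\<forall>j\<in>J. (\<Sum>i\<in>I. A j i * f i) = 0)"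
  using assms
proof (induction J arbitrary: I A rule: finite_induct)
  case empty
  then obtain i where "i \<in> I" by fastforce
  then show ?case by (intro exI [of _ "\<lambda>_. 1"]) auto
next
  case (insert j J)
  show ?case
  proof (cases "\<forall>i\<in>I. A j i = 0")
    case True
    moreover obtain f where "\<exists>i\<in>I. f i \<noteq> 0" "\<forall>k\<in>J. (\<Sum>i\<in>I. A k i * f i) = 0"
      using insert.IH [of I A] insert.prems insert.hyps by auto
    ultimately show ?thesis by (intro exI [of _ f]) auto
  next
    case False
    then obtain i0 where i0: "i0 \<in> I" "A j i0 \<noteq> 0" by auto
    define I' where "I' = I - {i0}"
    have I: "I = insert i0 I'" "i0 \<notin> I'" "finite I'" using i0 insert.prems by (auto simp: I'_def)
    have "card J < card I'" using insert.prems insert.hyps I by simp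
    from insert.IH [OF \<open>finite I'\<close> this, of "\<lambda>k i. A k i - A k i0 * A j i / A j i0"]
    obtain f where f: "\<exists>i\<in>I'. f i \<noteq> 0"
      "\<forall>k\<in>J. (\<Sum>i\<in>I'. (A k i - A k i0 * A j i / A j i0) * f i) = 0" by auto
    define s where "s = - (\<Sum>i\<in>I'. A j i * f i) / A j i0"
    have sum_upd: "(\<Sum>i\<in>I. A k i * (f(i0 := s)) i) = A k i0 * s + (\<Sum>i\<in>I'. A k i * f i)" for k
    proof -
      have "(\<Sum>i\<in>I'. A k i * (f(i0 := s)) i) = (\<Sum>i\<in>I'. A k i * f i)"
        using I by (intro sum.cong) auto
      then show ?thesis using I by simp
    qed
    have "(\<Sum>i\<in>I. A k i * (f(i0 := s)) i) = 0" if "k \<in> J" for k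
    proof -
      have "(\<Sum>i\<in>I'. A k i * f i) - A k i0 * (\<Sum>i\<in>I'. A j i * f i) / A j i0 = 0"
        using f(2) that by (simp add: algebra_simps sum_subtractf sum_distrib_left sum_divide_distrib)
      then show ?thesis unfolding sum_upd by (simp add: s_def)
    qed
    moreover have "(\<Sum>i\<in>I. A j i * (f(i0 := s)) i) = 0"
      unfolding sum_upd using i0 by (simp add: s_def)
    moreover have "\<exists>i\<in>I. (f(i0 := s)) i \<noteq> 0" using f(1) I by auto
    ultimately show ?thesis by (intro exI [of _ "f(i0 := s)"]) auto
  qed
qed

text \<open>Homogenization: the right-hand side becomes the column of an additional unknown
  \<open>None\<close>, so that there are more unknowns than equations. By injectivity a nontrivial
  solution has a nonzero entry at \<open>None\<close>, and dividing by this entry solves the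
  original system.\<close>

lemma square_system_solvable:
  fixes A :: "'i \<Rightarrow> 'i \<Rightarrow> real"
  assumes "finite I"
    and inj: "\<And>f. (\<And>j. j \<in> I \<Longrightarrow> (\<Sum>i\<in>I. A j i * f i) = 0) \<Longrightarrow> (\<And>i. i \<in> I \<Longrightarrow> f i = 0)"
  shows "\<exists>f. \<forall>j\<in>I. (\<Sum>i\<in>I. A j i * f i) = b j"
proof -
  define B where "B j k = (case k of None \<Rightarrow> - b j | Some i \<Rightarrow> A j i)" for j k
  have "card I < card (insert None (Some ` I))"
    using assms by (simp add: card_image)
  from underdetermined_system [OF \<open>finite I\<close> _ this, of B] assms(1)
  obtain f where f: "\<exists>k\<in>insert None (Some ` I). f k \<noteq> 0"
      "\<forall>j\<in>I. (\<Sum>k\<in>insert None (Some ` I). B j k * f k) = 0" by auto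
  have "(\<Sum>k\<in>insert None (Some ` I). B j k * f k) = - b j * f None + (\<Sum>i\<in>I. A j i * f (Some i))" for j
    using assms(1) by (simp add: B_def sum.reindex)
  with f(2) have *: "(\<Sum>i\<in>I. A j i * f (Some i)) = b j * f None" if "j \<in> I" for j
    using that by fastforce
  have "f None \<noteq> 0"
  proof
    assume "f None = 0"
    with * inj [of "\<lambda>i. f (Some i)"] f(1) show False by auto
  qed
  then have "(\<Sum>i\<in>I. A j i * (f (Some i) / f None)) = b j" if "j \<in> I" for j
    using * [OF that] by (simp flip: sum_divide_distrib)
  then show ?thesis by (intro exI [of _ "\<lambda>i. f (Some i) / f None"]) auto
qed

text \<open>The Laplacian without the row and column of \<open>p\<close> is injective: a function in
  its kernel, extended by 0 to \<open>p\<close>, has zero energy, hence is constant by connectedness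
  and equal to its value at \<open>p\<close>.\<close>

lemma (in fin_digraph) exists_green_network:
  assumes "Digraph_Component.connected G" and L: "\<And>e. e \<in> arcs G \<Longrightarrow> 0 < L e" and "p \<in> verts G"
  shows "\<exists>g. green_network G L p g"
proof -
  define I where "I = verts G - {p}"
  define A where "A w u = current_out G L (\<lambda>x. if x = u then 1 else 0) w" for w u
  have fI: "finite I" by (simp add: I_def)
  have co_sum: "current_out G L (\<lambda>x. \<Sum>i\<in>K. F i x * c i) w = (\<Sum>i\<in>K. current_out G L (F i) w * c i)"
    for K :: "'a set" and F :: "'a \<Rightarrow> 'a \<Rightarrow> real" and c w
  proof -
    have *: "((\<Sum>i\<in>K. F i x * c i) - (\<Sum>i\<in>K. F i y * c i)) / l = (\<Sum>i\<in>K. (F i x - F i y) / l * c i)"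
      for x y l
      by (simp only: sum_subtractf [symmetric] left_diff_distrib [symmetric] sum_divide_distrib times_divide_eq_left)
    show ?thesis
      unfolding current_out_def * distrib_right sum.distrib sum_distrib_right
      by (intro arg_cong2 [of _ _ _ _ "(+)"] sum.swap)
  qed
  have co: "current_out G L (\<lambda>x. if x \<in> I then f x else 0) w = (\<Sum>u\<in>I. A w u * f u)" for f w
  proof -
    have "(\<lambda>x. if x \<in> I then f x else 0) = (\<lambda>x. \<Sum>i\<in>I. (if x = i then 1 else 0) * f i)"
      using fI by (auto simp: fun_eq_iff if_distrib [of "\<lambda>a. a * _"] cong: if_cong)
    then show ?thesis unfolding A_def by (simp only: co_sum)
  qed
  have inj: "f i = 0" if hom: "\<And>j. j \<in> I \<Longrightarrow> (\<Sum>i\<in>I. A j i * f i) = 0" and "i \<in> I" for f i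
  proof -
    define F where "F x = (if x \<in> I then f x else 0)" for x
    have "energy G L F F = (\<Sum>u\<in>verts G. F u * current_out G L F u)" by (rule energy_current_out)
    also have "\<dots> = 0"
    proof (intro sum.neutral ballI)
      fix u assume "u \<in> verts G"
      show "F u * current_out G L F u = 0"
        using hom [of u] co [of f u] by (cases "u \<in> I") (auto simp: F_def [abs_def])
    qed
    finally have "(\<Sum>e\<in>arcs G. (incr G F e)\<^sup>2 / L e) = 0"
      by (simp add: energy_def power2_eq_square)
    moreover have "(incr G F e)\<^sup>2 / L e \<ge> 0" if "e \<in> arcs G" for e
      using L [OF that] by simp
    ultimately have "(incr G F e)\<^sup>2 / L e = 0" if "e \<in> arcs G" for e
      using that by (simp add: sum_nonneg_eq_0_iff)
    then have "F (tail G e) = F (head G e)" if "e \<in> arcs G" for e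
      using that L [OF that] by (fastforce simp: incr_def)
    then have "F i = F p"
      by (rule connected_imp_constant [OF wf_digraph assms(1)]) (use assms \<open>i \<in> I\<close> in \<open>auto simp: I_def\<close>)
    then show ?thesis using \<open>i \<in> I\<close> by (simp add: F_def I_def)
  qed
  have solv: "\<exists>f. \<forall>j\<in>I. (\<Sum>i\<in>I. A j i * f i) = b j" for b
  proof (rule square_system_solvable [OF fI])
    show "f i = 0" if "\<And>j. j \<in> I \<Longrightarrow> (\<Sum>i\<in>I. A j i * f i) = 0" "i \<in> I" for f i
      using that by (rule inj)
  qed
  have "\<exists>f. f p = 0 \<and> (\<forall>h. energy G L f h = h w - h p)" if w: "w \<in> verts G" for w
  proof -
    obtain f where f: "\<forall>j\<in>I. (\<Sum>i\<in>I. A j i * f i) = (if j = w then 1 else 0)"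
      using solv [of "\<lambda>j. if j = w then 1 else 0"] by blast
    define F where "F x = (if x \<in> I then f x else 0)" for x
    have cur: "current_out G L F u = (if u = w then 1 else 0)" if "u \<in> I" for u
      using f that co [of f u] by (simp add: F_def [abs_def])
    have I_sum: "(\<Sum>u\<in>verts G. k u) = k p + (\<Sum>u\<in>I. k u)" for k :: "'a \<Rightarrow> real"
      unfolding I_def using assms(3) by (simp add: sum.remove)
    \<comment> \<open>The currents out of all vertices add up to zero, so Kirchhoff's law at
      \<open>p\<close> follows from the law at the other vertices.\<close>
    have "energy G L F (\<lambda>_. 1) = 0" by (simp add: energy_def)
    then have tot: "current_out G L F p = - (\<Sum>u\<in>I. current_out G L F u)"
      unfolding energy_current_out I_sum by simp
    have "energy G L F h = h w - h p" for h
    proof -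
      have "energy G L F h = (\<Sum>u\<in>I. (h u - h p) * current_out G L F u)"
        unfolding energy_current_out I_sum tot
        by (simp add: left_diff_distrib sum_subtractf sum_distrib_left)
      also have "\<dots> = (\<Sum>u\<in>I. if u = w then h u - h p else 0)"
        by (intro sum.cong) (auto simp: cur)
      also have "\<dots> = h w - h p" using w fI by (auto simp: I_def)
      finally show ?thesis .
    qed
    moreover have "F p = 0" by (simp add: F_def I_def)
    ultimately show ?thesis by blast
  qed
  then obtain f where "\<And>w. w \<in> verts G \<Longrightarrow> f w p = 0 \<and> (\<forall>h. energy G L (f w) h = h w - h p)"
    by metis
  then have "green_network G L p (\<lambda>u w. f w u)"
    using L assms(3) by unfold_locales auto
  then show ?thesis by blast
qed

section \<open>Potentials and resistances of single arcs, Foster's theorem\<close>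

definition arc_potential ::
  "('n, 'k) pre_digraph \<Rightarrow> ('n \<Rightarrow> 'n \<Rightarrow> real) \<Rightarrow> 'k \<Rightarrow> 'n \<Rightarrow> real" where
  "arc_potential G g e u = g u (head G e) - g u (tail G e)"

definition arc_resistance ::
  "('n, 'k) pre_digraph \<Rightarrow> ('n \<Rightarrow> 'n \<Rightarrow> real) \<Rightarrow> 'k \<Rightarrow> real" where
  "arc_resistance G g e = incr G (arc_potential G g e) e"

text \<open>Three times the mean square of the linearly interpolated potential along the arc. For
  distinct end values a and b it equals (b^3 - a^3)/(b - a), the form in which it arises from the
  pairing E(h, h^3).\<close>

definition arc_moment ::
  "('n, 'k) pre_digraph \<Rightarrow> ('n \<Rightarrow> 'n \<Rightarrow> real) \<Rightarrow> 'k \<Rightarrow> real" where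
  "arc_moment G g e =
     (arc_potential G g e (tail G e))\<^sup>2 + arc_potential G g e (tail G e) * arc_potential G g e (head G e)
     + (arc_potential G g e (head G e))\<^sup>2"

context green_network
begin

abbreviation pot :: "'k \<Rightarrow> 'n \<Rightarrow> real" where "pot \<equiv> arc_potential G g"
abbreviation res :: "'k \<Rightarrow> real" where "res \<equiv> arc_resistance G g"

lemma card_verts_pos: "card (verts G) > 0"
  using base_in_verts finite_verts by (metis card_gt_0_iff empty_iff)

text \<open>In terms of currents, \<open>pot e\<close> is the potential of a unit current entering
  at the head of \<open>e\<close> and leaving at its tail.\<close>

lemma energy_pot:
  assumes "e \<in> arcs G"
  shows "energy G L (pot e) h = incr G h e"
  using energy_green_diff [of "head G e" "tail G e" 0 h] assms
  by (simp add: incr_def arc_potential_def [abs_def])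

lemma pot_base [simp]: "e \<in> arcs G \<Longrightarrow> pot e p = 0"
  by (simp add: arc_potential_def)

text \<open>Reciprocity: both sides are the energy pairing of \<open>pot e\<close> with
  \<open>pot f\<close>.\<close>

lemma incr_pot_commute:
  assumes "e \<in> arcs G" "f \<in> arcs G"
  shows "incr G (pot e) f = incr G (pot f) e"
  by (metis assms energy_pot energy_commute)

lemma incr_green:
  assumes "e \<in> arcs G" "w \<in> verts G"
  shows "incr G (\<lambda>u. g u w) e = pot e w"
  using assms by (simp add: incr_def arc_potential_def green_commute [of _ w])

text \<open>The sum is the energy pairing of two Green functions, written out arc by arc. It
  evaluates sums over all arcs that are quadratic in \<open>pot e\<close>.\<close>

lemma sum_pot_mult:
  assumes "u \<in> verts G" "w \<in> verts G"
  shows "(\<Sum>e\<in>arcs G. pot e u * pot e w / L e) = g u w"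
proof -
  have "(\<Sum>e\<in>arcs G. pot e u * pot e w / L e) = energy G L (\<lambda>x. g x w) (\<lambda>x. g x u)"
    unfolding energy_def using assms by (intro sum.cong) (simp_all add: incr_green mult.commute)
  also have "\<dots> = g u w" using assms by (simp add: energy_green green_commute)
  finally show ?thesis .
qed

text \<open>By reciprocity the sum is the power dissipated by a unit current between the ends of
  \<open>f\<close>, which is the resistance.\<close>

lemma sum_incr_pot_square:
  assumes "f \<in> arcs G"
  shows "(\<Sum>e\<in>arcs G. (incr G (pot e) f)\<^sup>2 / L e) = res f"
proof -
  have "(\<Sum>e\<in>arcs G. (incr G (pot e) f)\<^sup>2 / L e) = energy G L (pot f) (pot f)"
    unfolding energy_def using assms
    by (intro sum.cong) (simp_all add: incr_pot_commute [of _ f] power2_eq_square)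
  also have "\<dots> = res f" using assms by (simp add: energy_pot arc_resistance_def)
  finally show ?thesis .
qed

lemma res_nonneg: "f \<in> arcs G \<Longrightarrow> res f \<ge> 0"
  by (subst sum_incr_pot_square [symmetric]) (auto intro!: sum_nonneg divide_nonneg_pos length_pos)

lemma loop_pot: "tail G e = head G e \<Longrightarrow> pot e u = 0"
  by (simp add: arc_potential_def)

lemma loop_res: "tail G e = head G e \<Longrightarrow> res e = 0"
  by (simp add: arc_resistance_def incr_def)

lemma loop_moment: "tail G e = head G e \<Longrightarrow> arc_moment G g e = 0"
  by (simp add: arc_moment_def loop_pot)

text \<open>Zero resistance would make \<open>pot e\<close> constant along every arc, so its pairing
  with the indicator of the head of \<open>e\<close> would be 0; but \<open>energy_pot\<close> gives
  1.\<close>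

lemma res_pos:
  assumes e: "e \<in> arcs G" and "tail G e \<noteq> head G e"
  shows "res e > 0"
proof (rule ccontr)
  assume "\<not> res e > 0"
  with res_nonneg [OF e] have "res e = 0" by simp
  then have "(\<Sum>f\<in>arcs G. (incr G (pot f) e)\<^sup>2 / L f) = 0"
    using sum_incr_pot_square [OF e] by simp
  moreover have "(incr G (pot f) e)\<^sup>2 / L f \<ge> 0" if "f \<in> arcs G" for f
    using length_pos [OF that] by simp
  ultimately have "(incr G (pot f) e)\<^sup>2 / L f = 0" if "f \<in> arcs G" for f
    using that by (simp add: sum_nonneg_eq_0_iff)
  then have *: "incr G (pot e) f = 0" if "f \<in> arcs G" for f
    using that length_pos [OF that] incr_pot_commute [OF e that] by fastforce
  have "energy G L (pot e) (\<lambda>u. if u = head G e then 1 else 0) = 0"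
    unfolding energy_def by (intro sum.neutral) (simp add: *)
  then show False using assms by (simp add: energy_pot incr_def)
qed

text \<open>Foster's theorem as a trace computation: the pairing of g(.,w) with the indicator of w
  is 1 for w different from p and 0 for w = p. Summing over w first, with the arc fixed, leaves the
  increment of \<open>pot e\<close> along \<open>e\<close>.\<close>

lemma sum_res_div_length: "(\<Sum>e\<in>arcs G. res e / L e) = real (card (verts G)) - 1"
proof -
  define ind :: "'n \<Rightarrow> 'n \<Rightarrow> real" where "ind w u = (if u = w then 1 else 0)" for w u
  have "real (card (verts G)) - 1 = (\<Sum>w\<in>verts G. 1 - ind w p)"
    by (simp add: ind_def sum_subtractf)
  also have "\<dots> = (\<Sum>w\<in>verts G. energy G L (\<lambda>u. g u w) (ind w))"
    by (intro sum.cong) (simp_all add: energy_green, simp add: ind_def)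
  also have "\<dots> = (\<Sum>e\<in>arcs G. \<Sum>w\<in>verts G. incr G (\<lambda>u. g u w) e * incr G (ind w) e / L e)"
    unfolding energy_def by (rule sum.swap)
  also have "\<dots> = (\<Sum>e\<in>arcs G. res e / L e)"
  proof (intro sum.cong refl)
    fix e assume e: "e \<in> arcs G"
    have "(\<Sum>w\<in>verts G. incr G (\<lambda>u. g u w) e * incr G (ind w) e / L e)
        = (\<Sum>w\<in>verts G. incr G (\<lambda>u. g u w) e / L e * ind w (head G e))
        - (\<Sum>w\<in>verts G. incr G (\<lambda>u. g u w) e / L e * ind w (tail G e))"
      unfolding sum_subtractf [symmetric]
      by (intro sum.cong) (simp_all add: incr_def [of G "ind _"] algebra_simps diff_divide_distrib)
    also have "\<dots> = incr G (\<lambda>u. g u (head G e)) e / L e - incr G (\<lambda>u. g u (tail G e)) e / L e"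
    proof -
      have "(\<Sum>w\<in>verts G. c w * ind w x) = c x" if "x \<in> verts G" for c x
        using that by (subst sum.remove [of _ x]) (auto intro!: sum.neutral simp: ind_def split: if_splits)
      then show ?thesis using e by (simp only: head_in_verts tail_in_verts)
    qed
    also have "\<dots> = res e / L e"
      by (simp add: arc_resistance_def incr_def arc_potential_def diff_divide_distrib)
    finally show "(\<Sum>w\<in>verts G. incr G (\<lambda>u. g u w) e * incr G (ind w) e / L e) = res e / L e" .
  qed
  finally show ?thesis by simp
qed

section \<open>Weighted sums over all contractions\<close>

lemma sum_res_div_length_mult:
  "(\<Sum>e\<in>arcs G. res e / L e * c) = (real (card (verts G)) - 1) * c"
  unfolding sum_res_div_length [symmetric] by (rule sum_distrib_right [symmetric])

text \<open>
  For a loop \<open>e\<close> the following divisions by \<open>res e = 0\<close> are meaningless; they only occur with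
  weight \<open>res e\<close>.
\<close>

definition contracted_green :: "'k \<Rightarrow> 'n \<Rightarrow> 'n \<Rightarrow> real" where
  "contracted_green e u w = g u w - pot e u * pot e w / res e"

definition contracted_pot :: "'k \<Rightarrow> 'k \<Rightarrow> 'n \<Rightarrow> real" where
  "contracted_pot e f u = pot f u - pot e u * incr G (pot e) f / res e"

definition contracted_res :: "'k \<Rightarrow> 'k \<Rightarrow> real" where
  "contracted_res e f = res f - (incr G (pot e) f)\<^sup>2 / res e"

definition contracted_moment :: "'k \<Rightarrow> 'k \<Rightarrow> real" where
  "contracted_moment e f =
     (contracted_pot e f (tail G f))\<^sup>2 + contracted_pot e f (tail G f) * contracted_pot e f (head G f)
     + (contracted_pot e f (head G f))\<^sup>2"

text \<open>For fixed \<open>f\<close>, the weights contribute v - 1 times \<open>res f\<close> by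
  Foster, and the corrections add up to one \<open>res f\<close> by
  \<open>sum_incr_pot_square\<close>.\<close>

lemma sum_contracted_res:
  "(\<Sum>e\<in>arcs G. res e / L e * (\<Sum>f\<in>arcs G. contracted_res e f))
     = (real (card (verts G)) - 2) * (\<Sum>f\<in>arcs G. res f)"
proof -
  have "(\<Sum>e\<in>arcs G. res e / L e * (\<Sum>f\<in>arcs G. contracted_res e f))
      = (\<Sum>f\<in>arcs G. \<Sum>e\<in>arcs G. res e / L e * contracted_res e f)"
    unfolding sum_distrib_left by (rule sum.swap)
  also have "\<dots> = (\<Sum>f\<in>arcs G. (real (card (verts G)) - 2) * res f)"
  proof (intro sum.cong refl)
    fix f assume f: "f \<in> arcs G"
    have "res e / L e * contracted_res e f = res e / L e * res f - (incr G (pot e) f)\<^sup>2 / L e"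
      if "e \<in> arcs G" for e
    proof (cases "res e = 0")
      case True
      then have "tail G e = head G e" using res_pos [OF that] by fastforce
      then have "incr G (pot e) f = 0" by (simp add: incr_def loop_pot)
      with True show ?thesis by simp
    qed (simp add: contracted_res_def right_diff_distrib)
    then have "(\<Sum>e\<in>arcs G. res e / L e * contracted_res e f)
        = (\<Sum>e\<in>arcs G. res e / L e * res f - (incr G (pot e) f)\<^sup>2 / L e)"
      by (intro sum.cong) auto
    also have "\<dots> = (real (card (verts G)) - 2) * res f"
      unfolding sum_subtractf sum_res_div_length_mult sum_incr_pot_square [OF f]
      by (simp add: algebra_simps)
    finally show "(\<Sum>e\<in>arcs G. res e / L e * contracted_res e f) = (real (card (verts G)) - 2) * res f" .
  qed
  finally show ?thesis by (simp add: sum_distrib_left)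
qed

text \<open>After multiplication by \<open>res e\<close>, the contracted moment has a part free of
  \<open>pot f\<close> cross terms, a part \<open>mixed\<close> quadratic in \<open>pot e\<close>,
  and a part quartic in \<open>pot e\<close>. Summed over \<open>e\<close> and \<open>f\<close>, the
  original moments, the mixed terms and the quartic terms contribute v - 1, -2 and 1 times the total
  moment.\<close>

lemma sum_contracted_moment:
  "(\<Sum>e\<in>arcs G. res e / L e * (\<Sum>f\<in>arcs G. contracted_moment e f / L f))
     = (real (card (verts G)) - 2) * (\<Sum>f\<in>arcs G. arc_moment G g f / L f)"
proof -
  define mixed where "mixed e f =
      pot f (tail G f) * (pot e (tail G f) * pot e (head G f) - 2 * pot e (tail G f) * pot e (tail G f)
        + pot e (head G f) * pot e (head G f))
    + pot f (head G f) * (2 * pot e (head G f) * pot e (head G f) - pot e (tail G f) * pot e (head G f)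
        - pot e (tail G f) * pot e (tail G f))" for e f
  define Y where "Y = (\<Sum>f\<in>arcs G. arc_moment G g f / L f)"
  have expand: "res e * contracted_moment e f
      = res e * arc_moment G g f - mixed e f + incr G (pot e) f * incr G (\<lambda>u. (pot e u)^3) f / res e"
    if "e \<in> arcs G" for e f
  proof (cases "res e = 0")
    case True
    then have "tail G e = head G e" using res_pos [OF that] by fastforce
    with True show ?thesis by (simp add: mixed_def loop_pot)
  next
    case False
    have "r * ((x - h * (k - h) / r)\<^sup>2 + (x - h * (k - h) / r) * (y - k * (k - h) / r) + (y - k * (k - h) / r)\<^sup>2)
      = r * (x\<^sup>2 + x * y + y\<^sup>2)
        - (x * (h * k - 2 * h * h + k * k) + y * (2 * k * k - h * k - h * h))
        + (k - h) * (k ^ 3 - h ^ 3) / r" if "r \<noteq> 0" for r x y h k :: real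
      using that by (simp add: field_simps) algebra
    from this [OF False] show ?thesis
      by (simp add: contracted_moment_def contracted_pot_def arc_moment_def mixed_def incr_def)
  qed
  \<comment> \<open>Summation over \<open>e\<close> turns each product of two values of
    \<open>pot e\<close> into a value of \<open>g\<close> at the ends of \<open>f\<close>, and these
    recombine into \<open>pot f\<close>.\<close>
  have mixed: "(\<Sum>e\<in>arcs G. mixed e f / L e) = 2 * arc_moment G g f" if f: "f \<in> arcs G" for f
  proof -
    let ?a = "tail G f" and ?b = "head G f"
    have "(\<Sum>e\<in>arcs G. mixed e f / L e)
      = (\<Sum>e\<in>arcs G. pot f ?a * (pot e ?a * pot e ?b / L e - 2 * (pot e ?a * pot e ?a / L e)
          + pot e ?b * pot e ?b / L e)
        + pot f ?b * (2 * (pot e ?b * pot e ?b / L e) - pot e ?a * pot e ?b / L e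
          - pot e ?a * pot e ?a / L e))"
      by (intro sum.cong refl) (simp add: mixed_def algebra_simps add_divide_distrib diff_divide_distrib)
    also have "\<dots> = pot f ?a * (g ?a ?b - 2 * g ?a ?a + g ?b ?b) + pot f ?b * (2 * g ?b ?b - g ?a ?b - g ?a ?a)"
      using f by (simp only: sum.distrib sum_subtractf sum_distrib_left [symmetric] sum_pot_mult
          head_in_verts tail_in_verts)
    also have "\<dots> = 2 * arc_moment G g f"
      using f green_commute [of ?b ?a]
      by (simp add: arc_moment_def arc_potential_def power2_eq_square algebra_simps)
    finally show ?thesis .
  qed
  \<comment> \<open>The terms quartic in \<open>h = pot e\<close> form \<open>E(h, h\<^sup>3)\<close>, which only sees the ends of \<open>e\<close>.\<close>
  have cubes: "(\<Sum>f\<in>arcs G. incr G (pot e) f * incr G (\<lambda>u. (pot e u)^3) f / L f) / res e = arc_moment G g e"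
    if "e \<in> arcs G" for e
  proof (cases "tail G e = head G e")
    case True
    then show ?thesis by (simp add: loop_moment loop_res)
  next
    case False
    then have "res e \<noteq> 0" using res_pos [OF that] by simp
    moreover have "y ^ 3 - x ^ 3 = (y - x) * (x\<^sup>2 + x * y + y\<^sup>2)" for x y :: real
      by algebra
    ultimately show ?thesis
      using energy_pot [OF that, of "\<lambda>u. (pot e u)^3"]
      by (simp add: energy_def incr_def arc_moment_def arc_resistance_def)
  qed
  have "(\<Sum>e\<in>arcs G. res e / L e * (\<Sum>f\<in>arcs G. contracted_moment e f / L f))
      = (\<Sum>e\<in>arcs G. res e / L e * Y - (\<Sum>f\<in>arcs G. mixed e f / L f) / L e + arc_moment G g e / L e)"
  proof (intro sum.cong refl)
    fix e assume e: "e \<in> arcs G"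
    have "res e * (\<Sum>f\<in>arcs G. contracted_moment e f / L f)
        = (\<Sum>f\<in>arcs G. res e * (arc_moment G g f / L f) - mixed e f / L f
            + incr G (pot e) f * incr G (\<lambda>u. (pot e u)^3) f / L f / res e)"
      unfolding sum_distrib_left
      by (intro sum.cong refl)
        (simp add: expand [OF e] add_divide_distrib diff_divide_distrib mult.commute)
    also have "\<dots> = res e * Y - (\<Sum>f\<in>arcs G. mixed e f / L f) + arc_moment G g e"
      using cubes [OF e]
      by (simp add: sum.distrib sum_subtractf sum_distrib_left Y_def sum_divide_distrib)
    finally show "res e / L e * (\<Sum>f\<in>arcs G. contracted_moment e f / L f)
        = res e / L e * Y - (\<Sum>f\<in>arcs G. mixed e f / L f) / L e + arc_moment G g e / L e"
      by (simp add: add_divide_distrib diff_divide_distrib)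
  qed
  also have "\<dots> = (real (card (verts G)) - 1) * Y - (\<Sum>e\<in>arcs G. (\<Sum>f\<in>arcs G. mixed e f / L f) / L e) + Y"
    by (simp only: sum.distrib sum_subtractf sum_res_div_length_mult Y_def)
  also have "(\<Sum>e\<in>arcs G. (\<Sum>f\<in>arcs G. mixed e f / L f) / L e)
      = (\<Sum>f\<in>arcs G. (\<Sum>e\<in>arcs G. mixed e f / L e) / L f)"
    unfolding sum_divide_distrib by (subst sum.swap) (simp add: mult.commute)
  also have "\<dots> = 2 * Y" by (simp add: mixed Y_def sum_distrib_left)
  finally show ?thesis by (simp add: Y_def algebra_simps)
qed

end

section \<open>Contraction of an arc\<close>

text \<open>The head is merged into the tail. Arcs parallel to \<open>e\<close> are kept as loops,
  so exactly one arc and, for a non-loop, one vertex disappear.\<close>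

definition contract :: "('n, 'k) pre_digraph \<Rightarrow> 'k \<Rightarrow> ('n, 'k) pre_digraph" where
  "contract G e = \<lparr>verts = verts G - {head G e}, arcs = arcs G - {e},
     tail = (id(head G e := tail G e)) \<circ> tail G, head = (id(head G e := tail G e)) \<circ> head G\<rparr>"

context green_network
begin

text \<open>The rank-one correction makes the Green function equal at the two ends of
  \<open>e\<close>, so it descends to the quotient. A test function pulled back along the merging
  map \<open>m\<close> has no increment along \<open>e\<close>; hence its pairing with
  \<open>pot e\<close> vanishes and the weak form survives the correction.\<close>

lemma
  assumes e: "e \<in> arcs G" and "tail G e \<noteq> head G e"
  shows contracted_network:
      "green_network (contract G e) L ((id(head G e := tail G e)) p) (contracted_green e)" (is ?green)
    and arc_resistance_contract: "f \<in> arcs G \<Longrightarrow>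
      arc_resistance (contract G e) (contracted_green e) f = contracted_res e f"
    and arc_moment_contract: "f \<in> arcs G \<Longrightarrow>
      arc_moment (contract G e) (contracted_green e) f = contracted_moment e f"
proof -
  let ?C = "contract G e" and ?k = "contracted_green e"
  define a b where "a = tail G e" and "b = head G e"
  define m where "m = id(b := a)"
  have ab [simp]: "a \<in> verts G" "b \<in> verts G" "a \<noteq> b" and res_e: "res e > 0"
    using assms res_pos by (auto simp: a_def b_def)
  have res_eq: "res e = pot e b - pot e a"
    by (simp add: arc_resistance_def incr_def a_def b_def)
  have C [simp]: "verts ?C = verts G - {b}" "arcs ?C = arcs G - {e}"
      "tail ?C = m \<circ> tail G" "head ?C = m \<circ> head G"
    by (simp_all add: contract_def m_def a_def b_def)
  have m_verts [simp]: "m u \<in> verts G" "m u \<noteq> b" if "u \<in> verts G" for u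
    using that by (auto simp: m_def)
  interpret C: fin_digraph ?C by unfold_locales auto
  have k_commute: "?k u w = ?k w u" if "u \<in> verts G" "w \<in> verts G" for u w
    using that green_commute by (simp add: contracted_green_def)
  have k_m: "?k (m u) w = ?k u w" if "w \<in> verts G" for u w
  proof -
    have "?k b w - ?k a w = (g b w - g a w) - (pot e b - pot e a) * pot e w / res e"
      by (simp add: contracted_green_def algebra_simps diff_divide_distrib)
    also have "\<dots> = (g b w - g a w) - pot e w" using res_e by (simp flip: res_eq)
    also have "\<dots> = 0"
      using that green_commute [of _ w] by (simp add: arc_potential_def a_def [symmetric] b_def [symmetric])
    finally show ?thesis by (simp add: m_def)
  qed
  have k_m': "?k u (m w) = ?k u w" if "u \<in> verts G" "w \<in> verts G" for u w
    using k_m [of u w] k_commute [of u "m w"] k_commute [of u w] that by simp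
  show ?green
  proof (unfold_locales, goal_cases)
    case (1 f)
    then show ?case using length_pos by simp
  next
    case 2
    then show ?case using m_verts [of p] by (simp add: m_def a_def b_def)
  next
    case (3 w)
    then have "?k (m p) w = 0" using k_m [of w p] e by (simp add: contracted_green_def)
    then show ?case by (simp add: m_def a_def b_def)
  next
    case (4 w h)
    then have w: "w \<in> verts G" "m w = w" by (auto simp: m_def)
    have he: "incr G (h \<circ> m) e = 0"
      by (simp add: incr_def m_def a_def b_def)
    have "energy ?C L (\<lambda>u. ?k u w) h
        = (\<Sum>f\<in>arcs G - {e}. incr G (\<lambda>u. ?k u w) f * incr G (h \<circ> m) f / L f)"
      unfolding energy_def using w
      by (intro sum.cong) (simp_all add: incr_def k_m)
    also have "\<dots> = energy G L (\<lambda>u. ?k u w) (h \<circ> m)"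
      unfolding energy_def using e he by (simp add: sum.remove)
    also have "\<dots> = energy G L (\<lambda>u. g u w) (h \<circ> m) - energy G L (\<lambda>u. pot e w / res e * pot e u) (h \<circ> m)"
      by (simp add: contracted_green_def [abs_def] energy_diff_left [symmetric] mult.commute)
    also have "\<dots> = h w - h (m p)"
      unfolding energy_mult_left energy_green [OF w(1)] energy_pot [OF e] he by (simp add: w)
    finally show ?case by (simp add: m_def a_def b_def)
  qed
  have pot_C: "arc_potential ?C ?k f u = contracted_pot e f u"
    if "f \<in> arcs G" "u \<in> verts G" for f u
  proof -
    have "arc_potential ?C ?k f u = ?k u (head G f) - ?k u (tail G f)"
      using that by (simp add: arc_potential_def k_m')
    also have "\<dots> = contracted_pot e f u"
      by (simp add: contracted_green_def contracted_pot_def arc_potential_def [of G g f] incr_def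
          algebra_simps diff_divide_distrib)
    finally show ?thesis .
  qed
  have pot_m: "contracted_pot e f (m u) = contracted_pot e f u" if "f \<in> arcs G" "u \<in> verts G" for f u
    using that pot_C [of f u] pot_C [of f "m u"] k_m by (simp add: arc_potential_def)
  show "arc_resistance ?C ?k f = contracted_res e f" if "f \<in> arcs G" for f
    using that
    by (simp add: arc_resistance_def incr_def pot_C pot_m)
      (simp add: contracted_pot_def contracted_res_def arc_resistance_def incr_def power2_eq_square
        algebra_simps diff_divide_distrib add_divide_distrib)
  show "arc_moment ?C ?k f = contracted_moment e f" if "f \<in> arcs G" for f
    using that by (simp add: arc_moment_def contracted_moment_def pot_C pot_m)
qed

text \<open>This allows sums over the arcs of the contraction to be written as sums over all arcs of
  the graph.\<close>

lemma contracted_self: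
  assumes "e \<in> arcs G" "tail G e \<noteq> head G e"
  shows "contracted_res e e = 0" "contracted_moment e e = 0"
proof -
  have "res e \<noteq> 0" using res_pos [OF assms] by simp
  then show "contracted_res e e = 0" "contracted_moment e e = 0"
    by (simp_all add: contracted_res_def contracted_moment_def contracted_pot_def
        power2_eq_square flip: arc_resistance_def)
qed

text \<open>The n non-loop arcs are resistors in parallel between the same two vertices, with common
  resistance r, so S = n r and Y = r. The first two bounds say that n lies between \<open>k\<close>
  and the number of arcs; the third rests on the inequality between harmonic and arithmetic mean, r
  n^2 being at most the total length.\<close>

lemma two_vertices_bounds:
  assumes "card (verts G) = 2"
    and cut: "\<And>S. S \<subseteq> verts G \<Longrightarrow> S \<noteq> {} \<Longrightarrow> S \<noteq> verts G \<Longrightarrow>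
      k \<le> real (card {e \<in> arcs G. (tail G e \<in> S) \<noteq> (head G e \<in> S)})"
  defines "S \<equiv> \<Sum>e\<in>arcs G. res e" and "Y \<equiv> \<Sum>e\<in>arcs G. arc_moment G g e / L e"
  shows "k * Y \<le> S" "S \<le> real (card (arcs G)) * Y" "k * (S - Y) \<le> (\<Sum>e\<in>arcs G. L e) - S"
proof -
  obtain q where q: "verts G = {p, q}" "p \<noteq> q"
    using assms(1) base_in_verts unfolding card_2_iff by (metis insert_commute insert_iff singleton_iff)
  define r where "r = g q q"
  define N where "N = {e \<in> arcs G. tail G e \<noteq> head G e}"
  define n where "n = real (card N)"
  have [simp]: "finite N" and NG: "N \<subseteq> arcs G" by (auto simp: N_def)
  have ends: "tail G e = p \<and> head G e = q \<or> tail G e = q \<and> head G e = p" if "e \<in> N" for e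
    using that q tail_in_verts [of e] head_in_verts [of e] by (auto simp: N_def simp del: tail_in_verts head_in_verts)
  have gpq: "g p q = 0" "g q p = 0" "g p p = 0"
    using green_commute [of p q] q by (simp_all add: q(1))
  have res_N: "res e = r" and mom_N: "arc_moment G g e = r\<^sup>2" if "e \<in> N" for e
    using ends [OF that] gpq
    by (elim disjE conjE; simp add: arc_resistance_def incr_def arc_moment_def arc_potential_def r_def power2_eq_square)+
  have sum_N: "(\<Sum>e\<in>arcs G. F e) = (\<Sum>e\<in>N. F e)" if "\<And>e. tail G e = head G e \<Longrightarrow> F e = 0" for F :: "'k \<Rightarrow> real"
    using that by (intro sum.mono_neutral_right) (auto simp: N_def)
  have "(\<Sum>e\<in>N. res e / L e) = 1"
    using sum_res_div_length assms(1) by (subst sum_N [symmetric]) (simp_all add: loop_res)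
  then have rc: "r * (\<Sum>e\<in>N. 1 / L e) = 1"
    by (simp add: res_N sum_distrib_left)
  have "N \<noteq> {}" using rc by auto
  then have n: "n \<ge> 1" by (simp add: n_def card_gt_0_iff Suc_le_eq)
  have r: "r > 0"
  proof -
    obtain e where "e \<in> N" using \<open>N \<noteq> {}\<close> by auto
    then show ?thesis using res_pos [of e] res_N [of e] by (simp add: N_def)
  qed
  have S: "S = n * r"
    unfolding S_def by (subst sum_N) (simp_all add: loop_res res_N n_def)
  have "Y = (\<Sum>e\<in>N. r\<^sup>2 / L e)"
    unfolding Y_def by (subst sum_N) (simp_all add: loop_moment mom_N)
  also have "\<dots> = r * (r * (\<Sum>e\<in>N. 1 / L e))"
    by (simp add: sum_distrib_left power2_eq_square mult.assoc)
  finally have Y: "Y = r" by (simp add: rc)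
  have "{e \<in> arcs G. (tail G e \<in> {q}) \<noteq> (head G e \<in> {q})} = N"
    using ends q by (auto simp: N_def)
  with cut [of "{q}"] q have k: "k \<le> n" by (auto simp: n_def)
  show "k * Y \<le> S" using k r by (simp add: S Y)
  have "n \<le> real (card (arcs G))" using NG by (simp add: n_def card_mono)
  then show "S \<le> real (card (arcs G)) * Y" using r by (simp add: S Y)
  have "n\<^sup>2 = (\<Sum>e\<in>N. sqrt (L e) * sqrt (1 / L e))\<^sup>2"
    using NG length_pos by (simp add: n_def real_sqrt_mult [symmetric] subset_iff less_imp_neq [THEN not_sym])
  also have "\<dots> \<le> (\<Sum>e\<in>N. (sqrt (L e))\<^sup>2) * (\<Sum>e\<in>N. (sqrt (1 / L e))\<^sup>2)"
    by (rule Cauchy_Schwarz_ineq_sum)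
  also have "\<dots> = (\<Sum>e\<in>N. L e) * (\<Sum>e\<in>N. 1 / L e)"
    using NG length_pos by (intro arg_cong2 [of _ _ _ _ "(*)"] sum.cong) (auto simp: subset_iff less_imp_le)
  finally have "r * n\<^sup>2 \<le> r * ((\<Sum>e\<in>N. L e) * (\<Sum>e\<in>N. 1 / L e))"
    using r by simp
  also have "\<dots> = (\<Sum>e\<in>N. L e) * (r * (\<Sum>e\<in>N. 1 / L e))"
    by (simp only: mult_ac)
  also have "\<dots> \<le> (\<Sum>e\<in>arcs G. L e)"
    unfolding rc mult_1_right using NG length_pos by (intro sum_mono2) (auto simp: less_imp_le)
  finally have *: "r * n\<^sup>2 \<le> (\<Sum>e\<in>arcs G. L e)" .
  have "k * (n * r - r) \<le> n * (n * r - r)"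
    using k n r by (intro mult_right_mono) auto
  also have "\<dots> = r * n\<^sup>2 - n * r" by (simp add: power2_eq_square algebra_simps)
  finally show "k * (S - Y) \<le> (\<Sum>e\<in>arcs G. L e) - S" using * by (simp add: S Y)
qed

end

text \<open>The hypothesis is a bound on the size of every cut, which passes to contractions because
  their cuts lift to cuts of the same size. The factor in the second bound is the genus plus 1 and
  is unchanged by contracting a non-loop. The induction step averages the three bounds over all
  contractions with weights \<open>res e / L e\<close>.\<close>

lemma network_bounds:
  fixes k :: real
  assumes "green_network G L p g"
    and "\<And>S. S \<subseteq> verts G \<Longrightarrow> S \<noteq> {} \<Longrightarrow> S \<noteq> verts G \<Longrightarrow>
      k \<le> real (card {e \<in> arcs G. (tail G e \<in> S) \<noteq> (head G e \<in> S)})"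
  defines "R \<equiv> \<Sum>e\<in>arcs G. arc_resistance G g e" and "Y \<equiv> \<Sum>e\<in>arcs G. arc_moment G g e / L e"
  shows "k * Y \<le> R \<and> R \<le> (real (card (arcs G)) - real (card (verts G)) + 2) * Y
    \<and> k * (R - Y) \<le> (real (card (verts G)) - 1) * ((\<Sum>e\<in>arcs G. L e) - R)"
  using assms(1,2) unfolding R_def Y_def
proof (induction "card (verts G)" arbitrary: G p g rule: less_induct)
  case less
  interpret green_network G L p g by fact
  let ?n = "card (verts G)" and ?C = "contract G"
  define R where "R = (\<Sum>e\<in>arcs G. res e)"
  define Y where "Y = (\<Sum>e\<in>arcs G. arc_moment G g e / L e)"
  define T where "T = (\<Sum>e\<in>arcs G. L e)"
  consider "?n = 1" | "?n = 2" | "?n \<ge> 3" using card_verts_pos by linarith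
  then show ?case
  proof cases
    case 1
    then have "tail G e = head G e" if "e \<in> arcs G" for e
      using that by (metis card_1_singletonE head_in_verts singletonD tail_in_verts)
    then show ?thesis using 1 by (simp add: loop_res loop_moment)
  next
    case 2
    with two_vertices_bounds [OF 2 less.prems(2)] show ?thesis by simp
  next
    case 3
    define Rc where "Rc e = (\<Sum>f\<in>arcs G. contracted_res e f)" for e
    define Yc where "Yc e = (\<Sum>f\<in>arcs G. contracted_moment e f / L f)" for e
    have sumR: "(\<Sum>e\<in>arcs G. res e / L e * Rc e) = (real ?n - 2) * R"
      unfolding Rc_def R_def by (rule sum_contracted_res)
    have sumY: "(\<Sum>e\<in>arcs G. res e / L e * Yc e) = (real ?n - 2) * Y"
      unfolding Yc_def Y_def by (rule sum_contracted_moment)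
    have w: "res e / L e \<ge> 0" if "e \<in> arcs G" for e
      using res_nonneg [OF that] length_pos [OF that] by simp
    have step: "k * Yc e \<le> Rc e \<and> Rc e \<le> (real (card (arcs G)) - real ?n + 2) * Yc e
        \<and> k * (Rc e - Yc e) \<le> (real ?n - 2) * (T - L e - Rc e)"
      if e: "e \<in> arcs G" and ne: "tail G e \<noteq> head G e" for e
    proof -
      have vC: "verts (?C e) = verts G - {head G e}" and aC: "arcs (?C e) = arcs G - {e}"
        by (simp_all add: contract_def)
      have cv: "card (verts (?C e)) = ?n - 1" using e by (simp add: vC)
      have "card (arcs G) > 0" using e by (auto simp: card_gt_0_iff)
      then have ca: "real (card (arcs (?C e))) = real (card (arcs G)) - 1"
        using e by (simp add: aC of_nat_diff)
      have cutC: "k \<le> real (card {f \<in> arcs (?C e). (tail (?C e) f \<in> S) \<noteq> (head (?C e) f \<in> S)})"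
        if S: "S \<subseteq> verts (?C e)" "S \<noteq> {}" "S \<noteq> verts (?C e)" for S
      proof -
        \<comment> \<open>The preimage of \<open>S\<close> under the merging map contains both ends
          of \<open>e\<close> or neither, so its cut avoids \<open>e\<close> and consists of the
          same arcs.\<close>
        define m where "m = id(head G e := tail G e)"
        define S' where "S' = {u \<in> verts G. m u \<in> S}"
        have "S \<subseteq> S'" using S(1) by (auto simp: S'_def m_def vC)
        moreover obtain u where "u \<in> verts (?C e)" "u \<notin> S" using S by auto
        then have "u \<in> verts G" "u \<notin> S'" by (auto simp: S'_def m_def vC)
        ultimately have "k \<le> real (card {f \<in> arcs G. (tail G f \<in> S') \<noteq> (head G f \<in> S')})"
          using S(2) by (intro less.prems(2)) (auto simp: S'_def)
        also have "{f \<in> arcs G. (tail G f \<in> S') \<noteq> (head G f \<in> S')}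
            = {f \<in> arcs (?C e). (tail (?C e) f \<in> S) \<noteq> (head (?C e) f \<in> S)}"
          using e by (auto simp: S'_def contract_def m_def)
        finally show ?thesis .
      qed
      have "card (verts (?C e)) < ?n" using cv 3 by simp
      note IH = less.hyps [OF this contracted_network [OF e ne] cutC]
      have "(\<Sum>f\<in>arcs (?C e). arc_resistance (?C e) (contracted_green e) f) = Rc e"
        using e contracted_self(1) [OF e ne] arc_resistance_contract [OF e ne]
        by (simp add: aC Rc_def sum.remove)
      moreover have "(\<Sum>f\<in>arcs (?C e). arc_moment (?C e) (contracted_green e) f / L f) = Yc e"
        using e contracted_self(2) [OF e ne] arc_moment_contract [OF e ne]
        by (simp add: aC Yc_def sum.remove)
      moreover have "(\<Sum>f\<in>arcs (?C e). L f) = T - L e"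
        using e by (simp add: aC T_def sum.remove)
      moreover have "real (card (verts (?C e))) = real ?n - 1" using cv 3 by simp
      ultimately show ?thesis using IH ca by simp
    qed
    have le: "(\<Sum>e\<in>arcs G. res e / L e * A e) \<le> (\<Sum>e\<in>arcs G. res e / L e * B e)"
      if "\<And>e. e \<in> arcs G \<Longrightarrow> tail G e \<noteq> head G e \<Longrightarrow> A e \<le> B e" for A B
    proof (rule sum_mono)
      fix e assume e: "e \<in> arcs G"
      show "res e / L e * A e \<le> res e / L e * B e"
      proof (cases "tail G e = head G e")
        case False
        from that [OF e this] w [OF e] show ?thesis by (rule mult_left_mono)
      qed (simp add: loop_res)
    qed
    have scale: "(\<Sum>e\<in>arcs G. res e / L e * (c * A e)) = c * (\<Sum>e\<in>arcs G. res e / L e * A e)" for c A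
      by (simp only: sum_distrib_left mult.left_commute)
    have n2: "real ?n - 2 > 0" using 3 by simp
    have "k * ((real ?n - 2) * Y) \<le> (real ?n - 2) * R"
      using le [of "\<lambda>e. k * Yc e" Rc] step unfolding scale sumR sumY by blast
    then have 1: "k * Y \<le> R" using n2 by (simp add: mult.left_commute)
    have "(real ?n - 2) * R \<le> (real (card (arcs G)) - real ?n + 2) * ((real ?n - 2) * Y)"
      using le [of Rc "\<lambda>e. (real (card (arcs G)) - real ?n + 2) * Yc e"] step unfolding scale sumR sumY by blast
    then have 2: "R \<le> (real (card (arcs G)) - real ?n + 2) * Y"
      using n2 by (simp add: mult.left_commute)
    have "(\<Sum>e\<in>arcs G. res e / L e * (k * (Rc e - Yc e)))
        = k * ((real ?n - 2) * R - (real ?n - 2) * Y)"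
      unfolding scale sumR [symmetric] sumY [symmetric] by (simp only: right_diff_distrib sum_subtractf)
    \<comment> \<open>The lengths removed by the contractions have weighted sum R, so the bracket
      becomes (n - 1) T - R - (n - 2) R = (n - 1) (T - R).\<close>
    moreover have "(\<Sum>e\<in>arcs G. res e / L e * ((real ?n - 2) * (T - L e - Rc e)))
        = (real ?n - 2) * ((real ?n - 1) * T - R - (real ?n - 2) * R)"
    proof -
      have "(\<Sum>e\<in>arcs G. res e / L e * L e) = R"
        unfolding R_def using length_pos by (intro sum.cong) (auto simp: less_imp_neq [THEN not_sym])
      then show ?thesis
        unfolding scale right_diff_distrib sum_subtractf sumR sum_res_div_length_mult by simp
    qed
    ultimately have "k * ((real ?n - 2) * R - (real ?n - 2) * Y)
        \<le> (real ?n - 2) * ((real ?n - 1) * T - R - (real ?n - 2) * R)"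
      using le [of "\<lambda>e. k * (Rc e - Yc e)" "\<lambda>e. (real ?n - 2) * (T - L e - Rc e)"] step by simp
    then have "(real ?n - 2) * (k * (R - Y)) \<le> (real ?n - 2) * ((real ?n - 1) * (T - R))"
      by (simp add: algebra_simps)
    then have "k * (R - Y) \<le> (real ?n - 1) * (T - R)"
      using n2 mult_le_cancel_left_pos by blast
    with 1 2 show ?thesis by (simp add: R_def Y_def T_def)
  qed
qed

section \<open>The invariants x and y\<close>

context green_network
begin

text \<open>This is the effective resistance between \<open>u\<close> and the base point
  \<open>p\<close>, where \<open>g\<close> vanishes.\<close>

abbreviation diag :: "'n \<Rightarrow> real" where "diag u \<equiv> g u u"

lemma incr_diag:
  assumes "e \<in> arcs G"
  shows "incr G diag e = arc_potential G g e (head G e) + arc_potential G g e (tail G e)"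
  using assms green_commute [of "head G e" "tail G e"] by (simp add: incr_def arc_potential_def)

text \<open>4 (a^2 + a b + b^2) = (b - a)^2 + 3 (a + b)^2; the two squares correspond to the two
  sums in the definition of y.\<close>

lemma four_arc_moment:
  assumes "e \<in> arcs G"
  shows "4 * arc_moment G g e = (res e)\<^sup>2 + 3 * (incr G diag e)\<^sup>2"
  unfolding incr_diag [OF assms]
  by (simp add: arc_moment_def arc_resistance_def incr_def power2_eq_square algebra_simps)

lemma arc_moment_nonneg: "e \<in> arcs G \<Longrightarrow> arc_moment G g e \<ge> 0"
  using four_arc_moment [of e] by (smt (verit) zero_le_power2)

text \<open>Let \<open>f\<close> be the potential, in the graph without \<open>e\<close>, of a unit
  current between the ends of \<open>e\<close>, grounded at the tail. Restoring \<open>e\<close> in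
  parallel scales it by c = L/(L + R), the share of the current still flowing through the rest of
  the graph; subtracting the value at \<open>p\<close> gives \<open>pot e\<close>.\<close>

lemma
  assumes e: "e \<in> arcs G" and "green_network (del_arc e) L (tail G e) g'"
  shows edge_R_nonneg: "edge_R G L e \<ge> 0"
    and res_eq_edge_R: "res e = L e * edge_R G L e / (L e + edge_R G L e)"
    and incr_diag_eq_edge_Ra_Rb:
      "incr G diag e = L e * (edge_Rb G L p e - edge_Ra G L p e) / (L e + edge_R G L e)"
proof -
  interpret H: green_network "del_arc e" L "tail G e" g' by fact
  let ?a = "tail G e" and ?b = "head G e"
  define f where "f u = g' u ?b" for u
  have ends [simp]: "?a \<in> verts (del_arc e)" "?b \<in> verts (del_arc e)" "p \<in> verts (del_arc e)"
    using e by simp_all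
  have fa: "f ?a = 0" "g' ?b ?a = 0" "g' p ?a = 0" "g' ?a ?a = 0" "g' ?a p = 0"
    using e H.green_base [of ?b] H.green_base [of p] H.green_base [of ?a]
      H.green_commute [of ?a ?b] H.green_commute [of ?a p]
    by (simp_all add: f_def)
  have fb: "g' ?b p = f p" using H.green_commute [of ?b p] by (simp add: f_def e)
  have R: "edge_R G L e = f ?b"
    unfolding edge_R_def H.effective_resistance_eq_green [OF ends(1,2)]
    using fa by (simp add: f_def)
  have Ra: "edge_Ra G L p e = f p"
    unfolding edge_Ra_def H.voltage_eq_green [OF ends(3,2,1)]
    using fa by (simp add: f_def)
  have Rb: "edge_Rb G L p e = f ?b - f p"
    unfolding edge_Rb_def H.voltage_eq_green [OF ends(1,3,2)]
    using fa fb by (simp add: f_def)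
  have energy_f: "energy (del_arc e) L f h = incr G h e" for h
    using H.energy_green [OF ends(2), of h] by (simp add: f_def [abs_def] incr_def)
  have energy_G: "energy G L f h = energy (del_arc e) L f h + incr G f e * incr G h e / L e" for h
    using e by (simp add: energy_def incr_def sum.remove)
  have incr_f: "incr G f e = f ?b" by (simp add: incr_def fa)
  have "energy (del_arc e) L f f \<ge> 0"
    unfolding energy_def by (intro sum_nonneg) (auto intro!: divide_nonneg_pos H.length_pos)
  then show R_nonneg: "edge_R G L e \<ge> 0" by (simp add: energy_f incr_f R)
  have L: "L e > 0" using length_pos [OF e] .
  define c where "c = L e / (L e + f ?b)"
  have c: "c * (1 + f ?b / L e) = 1"
  proof -
    have "1 + f ?b / L e = (L e + f ?b) / L e" using L by (simp add: add_divide_distrib)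
    then show ?thesis using L R_nonneg by (simp add: c_def R)
  qed
  have "energy G L (pot e) h = energy G L (\<lambda>u. c * f u) h" for h
  proof -
    have "energy G L (\<lambda>u. c * f u) h = c * (1 + f ?b / L e) * incr G h e"
      unfolding energy_mult_left energy_G energy_f incr_f by (simp add: algebra_simps)
    then show ?thesis by (simp add: c energy_pot [OF e])
  qed
  from energy_determines [OF this] have pot: "pot e u = c * f u - c * f p" if "u \<in> verts G" for u
    using that e by (simp add: algebra_simps)
  show "res e = L e * edge_R G L e / (L e + edge_R G L e)"
    using e by (simp add: arc_resistance_def incr_def pot fa R c_def)
  have "incr G diag e = c * (f ?b - 2 * f p)"
    unfolding incr_diag [OF e] using e by (simp add: pot fa algebra_simps)
  then show "incr G diag e = L e * (edge_Rb G L p e - edge_Ra G L p e) / (L e + edge_R G L e)"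
    by (simp add: R Ra Rb c_def)
qed

text \<open>Connectedness of each deleted graph provides its Green function, so every summand of x
  and y can be rewritten through \<open>res e\<close> and the increment of
  \<open>diag\<close>.\<close>

lemma
  assumes "\<And>e. e \<in> arcs G \<Longrightarrow> Digraph_Component.connected (del_arc e)"
  shows y_invariant_eq: "y_invariant G L p = (\<Sum>e\<in>arcs G. arc_moment G g e / L e)"
    and x_invariant_eq: "x_invariant G L p = (\<Sum>e\<in>arcs G. res e) - (\<Sum>e\<in>arcs G. arc_moment G g e / L e)"
proof -
  have terms: "L e * (edge_R G L e)\<^sup>2 / (L e + edge_R G L e)\<^sup>2 = (res e)\<^sup>2 / L e"
      "L e * (edge_Ra G L p e - edge_Rb G L p e)\<^sup>2 / (L e + edge_R G L e)\<^sup>2 = (incr G diag e)\<^sup>2 / L e"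
      "(L e)\<^sup>2 * edge_R G L e / (L e + edge_R G L e)\<^sup>2 = res e - (res e)\<^sup>2 / L e"
    if e: "e \<in> arcs G" for e
  proof -
    interpret H: fin_digraph "del_arc e" by (rule fin_digraph_del_arc)
    obtain g' where "green_network (del_arc e) L (tail G e) g'"
      using H.exists_green_network [OF assms [OF e], of L "tail G e"] length_pos e by auto
    note R = edge_R_nonneg [OF e this] res_eq_edge_R [OF e this] incr_diag_eq_edge_Ra_Rb [OF e this]
    have L: "L e > 0" using length_pos [OF e] .
    have "L e * r\<^sup>2 / (L e + r)\<^sup>2 = (L e * r / (L e + r))\<^sup>2 / L e"
      "(L e)\<^sup>2 * r / (L e + r)\<^sup>2 = L e * r / (L e + r) - (L e * r / (L e + r))\<^sup>2 / L e"
      "L e * (s - t)\<^sup>2 / (L e + r)\<^sup>2 = (L e * (t - s) / (L e + r))\<^sup>2 / L e" if "r \<ge> 0" for r s t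
    proof -
      have "L e + r \<noteq> 0" "L e \<noteq> 0" using L that by auto
      then show "L e * r\<^sup>2 / (L e + r)\<^sup>2 = (L e * r / (L e + r))\<^sup>2 / L e"
        "(L e)\<^sup>2 * r / (L e + r)\<^sup>2 = L e * r / (L e + r) - (L e * r / (L e + r))\<^sup>2 / L e"
        "L e * (s - t)\<^sup>2 / (L e + r)\<^sup>2 = (L e * (t - s) / (L e + r))\<^sup>2 / L e"
        by (simp_all add: divide_simps) algebra+
    qed
    from this [OF R(1)]
    show "L e * (edge_R G L e)\<^sup>2 / (L e + edge_R G L e)\<^sup>2 = (res e)\<^sup>2 / L e"
      "L e * (edge_Ra G L p e - edge_Rb G L p e)\<^sup>2 / (L e + edge_R G L e)\<^sup>2 = (incr G diag e)\<^sup>2 / L e"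
      "(L e)\<^sup>2 * edge_R G L e / (L e + edge_R G L e)\<^sup>2 = res e - (res e)\<^sup>2 / L e"
      unfolding R(2,3) by simp_all
  qed
  have moment: "arc_moment G g e / L e = 1/4 * ((res e)\<^sup>2 / L e) + 3/4 * ((incr G diag e)\<^sup>2 / L e)"
    if "e \<in> arcs G" for e
  proof -
    have "arc_moment G g e = 1/4 * (res e)\<^sup>2 + 3/4 * (incr G diag e)\<^sup>2"
      using four_arc_moment [OF that] by simp
    then show ?thesis by (simp add: add_divide_distrib)
  qed
  have Y: "(\<Sum>e\<in>arcs G. arc_moment G g e / L e)
      = 1/4 * (\<Sum>e\<in>arcs G. (res e)\<^sup>2 / L e) + 3/4 * (\<Sum>e\<in>arcs G. (incr G diag e)\<^sup>2 / L e)"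
    unfolding sum_distrib_left sum.distrib [symmetric] by (intro sum.cong refl moment)
  show "y_invariant G L p = (\<Sum>e\<in>arcs G. arc_moment G g e / L e)"
    unfolding y_invariant_def Y
    by (intro arg_cong2 [of _ _ _ _ "(+)"] arg_cong2 [of _ _ _ _ "(*)"] refl sum.cong terms)
  have "x_invariant G L p
      = (\<Sum>e\<in>arcs G. res e - (res e)\<^sup>2 / L e) + 3/4 * (\<Sum>e\<in>arcs G. (res e)\<^sup>2 / L e)
        - 3/4 * (\<Sum>e\<in>arcs G. (incr G diag e)\<^sup>2 / L e)"
    unfolding x_invariant_def
    by (intro arg_cong2 [of _ _ _ _ "(+)"] arg_cong2 [of _ _ _ _ "(-)"] arg_cong2 [of _ _ _ _ "(*)"]
        refl sum.cong terms)
  then show "x_invariant G L p = (\<Sum>e\<in>arcs G. res e) - (\<Sum>e\<in>arcs G. arc_moment G g e / L e)"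
    unfolding Y by (simp add: sum_subtractf)
qed

text \<open>
  The Dirichlet energy of the function \<open>u \<mapsto> r(u, q)\<close> does not depend on \<open>q\<close>; averaging
  over all vertices \<open>q\<close>, every arc contributes through its two end points.
\<close>

lemma sum_incr_diag_ge:
  "(\<Sum>e\<in>arcs G. (incr G diag e)\<^sup>2 / L e) \<ge> 2 / real (card (verts G)) * (\<Sum>e\<in>arcs G. (res e)\<^sup>2 / L e)"
proof -
  let ?D = "\<Sum>e\<in>arcs G. (incr G diag e)\<^sup>2 / L e"
  define d where "d q u = g u u - 2 * g u q" for q u
  \<comment> \<open>\<open>d q\<close> is r(.,q) up to a constant. The pairings of g(.,q) with
    \<open>diag\<close> and with itself both equal g(q,q), so the terms -4 g(q,q) and 4 g(q,q)
    cancel.\<close>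
  have "energy G L (d q) (d q) = energy G L diag diag" if "q \<in> verts G" for q
    using that
    by (simp add: d_def [abs_def] energy_diff_left energy_diff_right energy_mult_left energy_mult_right
        energy_commute [of G L diag "\<lambda>u. g u q"] energy_green)
  then have D: "(\<Sum>e\<in>arcs G. (incr G (d q) e)\<^sup>2 / L e) = ?D" if "q \<in> verts G" for q
    using that by (simp add: energy_def power2_eq_square)
  have "2 * (res e)\<^sup>2 / L e \<le> (\<Sum>q\<in>verts G. (incr G (d q) e)\<^sup>2 / L e)" if e: "e \<in> arcs G" for e
  proof (cases "tail G e = head G e")
    case True
    then show ?thesis
      using length_pos [OF e] by (auto simp: loop_res intro!: sum_nonneg)
  next
    case False
    have "2 * (res e)\<^sup>2 / L e = (\<Sum>q\<in>{tail G e, head G e}. (incr G (d q) e)\<^sup>2 / L e)"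
    proof -
      have "incr G (d (tail G e)) e = res e" "incr G (d (head G e)) e = - res e"
        using e green_commute [of "head G e" "tail G e"]
        by (simp_all add: d_def incr_def arc_resistance_def arc_potential_def)
      then show ?thesis using False by simp
    qed
    also have "\<dots> \<le> (\<Sum>q\<in>verts G. (incr G (d q) e)\<^sup>2 / L e)"
      using e length_pos [OF e] by (intro sum_mono2) auto
    finally show ?thesis .
  qed
  then have "(\<Sum>e\<in>arcs G. 2 * (res e)\<^sup>2 / L e)
      \<le> (\<Sum>e\<in>arcs G. \<Sum>q\<in>verts G. (incr G (d q) e)\<^sup>2 / L e)"
    by (rule sum_mono)
  also have "\<dots> = (\<Sum>q\<in>verts G. \<Sum>e\<in>arcs G. (incr G (d q) e)\<^sup>2 / L e)"
    by (rule sum.swap)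
  also have "\<dots> = real (card (verts G)) * ?D" by (simp add: D)
  finally have "2 * (\<Sum>e\<in>arcs G. (res e)\<^sup>2 / L e) \<le> real (card (verts G)) * ?D"
    by (simp add: sum_distrib_left)
  then show ?thesis using card_verts_pos by (simp add: field_simps)
qed

lemma sum_res_square_le:
  "(\<Sum>e\<in>arcs G. res e)\<^sup>2 \<le> (\<Sum>e\<in>arcs G. L e) * (\<Sum>e\<in>arcs G. (res e)\<^sup>2 / L e)"
proof -
  have "(\<Sum>e\<in>arcs G. res e)\<^sup>2 = (\<Sum>e\<in>arcs G. sqrt (L e) * (res e / sqrt (L e)))\<^sup>2"
    using length_pos by (intro arg_cong [of _ _ "\<lambda>a. a\<^sup>2"] sum.cong) (auto simp: less_imp_neq [THEN not_sym])
  also have "\<dots> \<le> (\<Sum>e\<in>arcs G. (sqrt (L e))\<^sup>2) * (\<Sum>e\<in>arcs G. (res e / sqrt (L e))\<^sup>2)"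
    by (rule Cauchy_Schwarz_ineq_sum)
  also have "\<dots> = (\<Sum>e\<in>arcs G. L e) * (\<Sum>e\<in>arcs G. (res e)\<^sup>2 / L e)"
    using length_pos by (intro arg_cong2 [of _ _ _ _ "(*)"] sum.cong) (auto simp: less_imp_le power_divide)
  finally show ?thesis .
qed

text \<open>The constant is 1/4 + 3/4 * 2/n = (n + 6)/(4 n), from inserting
  \<open>sum_incr_diag_ge\<close> into \<open>four_arc_moment\<close>; Cauchy-Schwarz then bounds
  the sum of squares below by the square of the sum.\<close>

lemma moment_bound:
  "(\<Sum>e\<in>arcs G. L e) * (\<Sum>e\<in>arcs G. arc_moment G g e / L e)
    \<ge> (real (card (verts G)) + 6) / (4 * real (card (verts G))) * (\<Sum>e\<in>arcs G. res e)\<^sup>2"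
proof -
  let ?n = "real (card (verts G))" and ?C = "\<Sum>e\<in>arcs G. (res e)\<^sup>2 / L e"
    and ?D = "\<Sum>e\<in>arcs G. (incr G diag e)\<^sup>2 / L e"
  have n: "?n > 0" using card_verts_pos by simp
  have "4 * (\<Sum>e\<in>arcs G. arc_moment G g e / L e) = ?C + 3 * ?D"
    unfolding sum_distrib_left sum.distrib [symmetric]
    by (intro sum.cong refl) (simp add: four_arc_moment add_divide_distrib)
  then have "(\<Sum>e\<in>arcs G. arc_moment G g e / L e) \<ge> 1/4 * ?C + 3/4 * (2 / ?n * ?C)"
    using sum_incr_diag_ge by simp
  also have "1/4 * ?C + 3/4 * (2 / ?n * ?C) = (?n + 6) / (4 * ?n) * ?C"
  proof -
    have "1/4 * c + 3/4 * (2 / m * c) = (m + 6) / (4 * m) * c" if "m > 0" for c m :: real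
      using that by (simp add: field_simps)
    from this [OF n] show ?thesis .
  qed
  finally have "(\<Sum>e\<in>arcs G. L e) * ((?n + 6) / (4 * ?n) * ?C)
      \<le> (\<Sum>e\<in>arcs G. L e) * (\<Sum>e\<in>arcs G. arc_moment G g e / L e)"
    using length_pos by (intro mult_left_mono sum_nonneg) (auto simp: less_imp_le)
  moreover have "(?n + 6) / (4 * ?n) * (\<Sum>e\<in>arcs G. res e)\<^sup>2
      \<le> (?n + 6) / (4 * ?n) * ((\<Sum>e\<in>arcs G. L e) * ?C)"
    using n sum_res_square_le by (intro mult_left_mono) auto
  ultimately show ?thesis by (simp add: mult.left_commute)
qed

end

section \<open>Edge connectivity and cuts\<close>

lemma (in fin_digraph) cut_card:
  assumes "Digraph_Component.connected G" and S: "S \<subseteq> verts G" "S \<noteq> {}" "S \<noteq> verts G"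
  defines "F \<equiv> {e \<in> arcs G. (tail G e \<in> S) \<noteq> (head G e \<in> S)}"
  shows "edge_connectivity G \<le> card F" "1 \<le> card F"
proof -
  obtain u w where u: "u \<in> verts G" "u \<in> S" and w: "w \<in> verts G" "w \<notin> S" using S by auto
  \<comment> \<open>Once the arcs of the cut are deleted, membership in \<open>S\<close> is constant
    along the remaining arcs.\<close>
  have cut: "\<not> Digraph_Component.connected (del_arcs G F)"
  proof
    assume conn: "Digraph_Component.connected (del_arcs G F)"
    have "wf_digraph (del_arcs G F)" by unfold_locales (auto simp: del_arcs_def)
    then have "(u \<in> S) = (w \<in> S)"
      by (rule connected_imp_constant) (use conn u w in \<open>auto simp: del_arcs_def F_def\<close>)
    with u w show False by simp
  qed
  then show "edge_connectivity G \<le> card F"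
    unfolding edge_connectivity_def by (intro wellorder_Inf_le1) (auto simp: F_def)
  have "del_arcs G {} = G" by (cases G) (simp add: del_arcs_def)
  then have "F \<noteq> {}" using cut assms(1) by metis
  then show "1 \<le> card F" by (simp add: F_def card_gt_0_iff Suc_le_eq)
qed

section \<open>Resistances between arbitrary points and the tau constant\<close>

definition consecutive :: "real set \<Rightarrow> (real \<times> real) set" where
  "consecutive D = {(s, t). s \<in> D \<and> t \<in> D \<and> s < t \<and> (\<forall>u\<in>D. \<not> (s < u \<and> u < t))}"

lemma finite_consecutive [simp]: "finite D \<Longrightarrow> finite (consecutive D)"
  by (rule finite_subset [of _ "D \<times> D"]) (auto simp: consecutive_def)

text \<open>Points are added in increasing order; a new maximum \<open>b\<close> creates the single
  new pair \<open>(Max D, b)\<close>.\<close>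

lemma sum_consecutive:
  fixes h :: "real \<Rightarrow> real"
  assumes "finite D" "D \<noteq> {}"
  shows "(\<Sum>(s, t)\<in>consecutive D. h t - h s) = h (Max D) - h (Min D)"
  using assms
proof (induction D rule: finite_linorder_max_induct)
  case (insert b D)
  show ?case
  proof (cases "D = {}")
    case True
    then have "consecutive (insert b D) = {}" by (auto simp: consecutive_def)
    with True show ?thesis by simp
  next
    case False
    have "consecutive (insert b D) = insert (Max D, b) (consecutive D)"
    proof (intro equalityI subrelI)
      fix s t assume st: "(s, t) \<in> consecutive (insert b D)"
      show "(s, t) \<in> insert (Max D, b) (consecutive D)"
      proof (cases "t = b")
        case True
        have "s \<in> D" using st True by (auto simp: consecutive_def)
        moreover have "\<not> s < Max D"
          using st True insert.hyps False Max_in [of D] by (auto simp: consecutive_def)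
        ultimately have "s = Max D" by (metis Max_ge insert.hyps(1) less_eq_real_def)
        with True show ?thesis by simp
      next
        case False
        then have "t \<in> D" using st by (auto simp: consecutive_def)
        with st insert.hyps show ?thesis by (force simp: consecutive_def)
      qed
    next
      have Max: "Max D \<in> D" "x \<le> Max D" "x < b" if "x \<in> D" for x
        using insert.hyps False that by auto
      fix s t assume "(s, t) \<in> insert (Max D, b) (consecutive D)"
      then consider "s = Max D" "t = b" | "(s, t) \<in> consecutive D" by auto
      then show "(s, t) \<in> consecutive (insert b D)"
      proof cases
        case 1
        then show ?thesis using Max False by (fastforce simp: consecutive_def)
      next
        case 2
        then show ?thesis using Max(3) by (fastforce simp: consecutive_def)
      qed
    qed
    moreover have "(Max D, b) \<notin> consecutive D" using insert.hyps by (auto simp: consecutive_def)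
    moreover have "Max (insert b D) = b"
      using insert.hyps by (intro Max_eqI) (auto simp: less_imp_le)
    moreover have "Min (insert b D) = Min D"
      using insert.hyps False by (simp add: Min_insert)
    ultimately show ?thesis using insert False by simp
  qed
qed simp

text \<open>The cut-off at \<open>m\<close> serves to isolate the part of an edge before the pole of
  the Green function.\<close>

lemma sum_consecutive_upto:
  fixes h :: "real \<Rightarrow> real"
  assumes "finite D" "l \<in> D" "m \<in> D" "\<And>s. s \<in> D \<Longrightarrow> l \<le> s"
  shows "(\<Sum>(s, t)\<in>consecutive D. if t \<le> m then h t - h s else 0) = h m - h l"
proof -
  let ?D = "{s \<in> D. s \<le> m}"
  have "(\<Sum>(s, t)\<in>consecutive D. if t \<le> m then h t - h s else 0)
      = (\<Sum>(s, t)\<in>consecutive ?D. if t \<le> m then h t - h s else 0)"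
    by (intro sum.mono_neutral_right finite_consecutive assms(1)) (auto simp: consecutive_def split: if_splits)
  also have "\<dots> = (\<Sum>(s, t)\<in>consecutive ?D. h t - h s)"
    by (intro sum.cong) (auto simp: consecutive_def)
  also have "\<dots> = h (Max ?D) - h (Min ?D)"
    using assms by (intro sum_consecutive) auto
  also have "Max ?D = m" using assms by (intro Max_eqI) auto
  also have "Min ?D = l" using assms by (intro Min_eqI) auto
  finally show ?thesis .
qed

section \<open>The Green function on all points of the metrized graph\<close>

definition interpolate ::
  "('n, 'k) pre_digraph \<Rightarrow> ('k \<Rightarrow> real) \<Rightarrow> ('n \<Rightarrow> real) \<Rightarrow> ('n, 'k) point \<Rightarrow> real" where
  "interpolate G L f x = (case x of Vertex u \<Rightarrow> f u
     | Inner e t \<Rightarrow> (1 - t / L e) * f (tail G e) + t / L e * f (head G e))"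

text \<open>
  The Green function of the segment \<open>[0, L e]\<close> with both ends grounded; it corrects the
  interpolation from the vertices inside an edge.
\<close>

definition segment_green :: "('k \<Rightarrow> real) \<Rightarrow> ('n, 'k) point \<Rightarrow> 'k \<Rightarrow> real \<Rightarrow> real" where
  "segment_green L x e t = (case x of Vertex u \<Rightarrow> 0
     | Inner e' s \<Rightarrow> if e' = e then min t s - t * s / L e else 0)"

text \<open>Interpolation in both arguments gives the part that is linear along each edge; the
  second summand adds the kink at the pole and is present only if both points are interior to the
  same edge.\<close>

definition point_green ::
  "('n, 'k) pre_digraph \<Rightarrow> ('k \<Rightarrow> real) \<Rightarrow> ('n \<Rightarrow> 'n \<Rightarrow> real)
    \<Rightarrow> ('n, 'k) point \<Rightarrow> ('n, 'k) point \<Rightarrow> real" where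
  "point_green G L g x y = interpolate G L (\<lambda>u. interpolate G L (g u) y) x
     + (case x of Vertex u \<Rightarrow> 0 | Inner e t \<Rightarrow> segment_green L y e t)"

context green_network
begin

lemma edge_point_in_points:
  assumes "e \<in> arcs G" "0 \<le> t" "t \<le> L e"
  shows "edge_point G L e t \<in> points G L"
  using assms by (auto simp: edge_point_def points_def)

lemma interpolate_edge_point:
  assumes "e \<in> arcs G"
  shows "interpolate G L f (edge_point G L e t) = f (tail G e) + t / L e * incr G f e"
  using length_pos [OF assms]
  by (auto simp: interpolate_def edge_point_def incr_def algebra_simps diff_divide_distrib)

lemma segment_green_ends:
  assumes "y \<in> points G L" "e \<in> arcs G"
  shows "segment_green L y e 0 = 0" "segment_green L y e (L e) = 0"
  using assms length_pos [OF assms(2)] by (auto simp: segment_green_def points_def)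

lemma point_green_edge_point:
  assumes "y \<in> points G L" "e \<in> arcs G" and "F = (\<lambda>u. interpolate G L (g u) y)"
  shows "point_green G L g (edge_point G L e t) y
    = F (tail G e) + t / L e * incr G F e + segment_green L y e t"
proof -
  have "(case edge_point G L e t of Vertex u \<Rightarrow> 0 | Inner e t \<Rightarrow> segment_green L y e t)
      = segment_green L y e t"
    using segment_green_ends [OF assms(1,2)] by (auto simp: edge_point_def)
  then show ?thesis
    unfolding point_green_def assms(3) interpolate_edge_point [OF assms(2)] by simp
qed

text \<open>For \<open>y\<close> inside an edge, the function is a combination of the Green
  functions of the two ends with weights of sum 1, and the weak form is linear.\<close>

lemma energy_interpolate:
  assumes "y \<in> points G L"
  shows "energy G L (\<lambda>u. interpolate G L (g u) y) h = interpolate G L h y - h p"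
proof (cases y)
  case (Vertex u)
  then show ?thesis using assms by (auto simp: points_def interpolate_def energy_green)
next
  case (Inner e t)
  then have "e \<in> arcs G" using assms by (auto simp: points_def)
  then have energies: "energy G L (\<lambda>u. g u (tail G e)) h = h (tail G e) - h p"
      "energy G L (\<lambda>u. g u (head G e)) h = h (head G e) - h p"
    by (simp_all add: energy_green)
  show ?thesis
    unfolding Inner interpolate_def point.case energy_add_left energy_mult_left energies
    by (simp add: algebra_simps)
qed

lemma finite_division_points:
  assumes "finite S"
  shows "finite (division_points L S e)"
proof -
  have "{t. Inner e t \<in> S} = Inner e -` S" by auto
  moreover have "finite (Inner e -` S)" using assms by (rule finite_vimageI) (auto simp: inj_on_def)
  ultimately show ?thesis by (simp add: division_points_def)
qed

lemma division_points_bounds: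
  assumes "S \<subseteq> points G L" "e \<in> arcs G" "t \<in> division_points L S e"
  shows "0 \<le> t" "t \<le> L e"
  using assms length_pos [OF assms(2)] by (auto simp: division_points_def points_def)

lemma arcs_subdivision_at:
  "arcs (subdivision_at G L S) = Sigma (arcs G) (\<lambda>e. consecutive (division_points L S e))"
  by (auto simp: subdivision_at_def consecutive_def)

text \<open>On each piece the increment ratio of the Green function is a constant slope, so the sum
  telescopes. The linear part gives the contribution of the undivided edge. For a pole at z the
  segment Green function has slope 1 - z/L before z and -z/L after it, which yields
  \<open>h y\<close> minus its interpolated value.\<close>

lemma energy_segments:
  fixes h :: "('n, 'k) point \<Rightarrow> real"
  assumes S: "finite S" "S \<subseteq> points G L" and y: "y \<in> points G L" "y \<in> Vertex ` verts G \<union> S"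
    and e: "e \<in> arcs G" and F: "F = (\<lambda>u. interpolate G L (g u) y)"
  defines "\<phi> \<equiv> \<lambda>t. h (edge_point G L e t)" and "k \<equiv> \<lambda>t. point_green G L g (edge_point G L e t) y"
  shows "(\<Sum>(s, t)\<in>consecutive (division_points L S e). (k t - k s) * (\<phi> t - \<phi> s) / (t - s))
     = incr G F e * incr G (h \<circ> Vertex) e / L e
       + (case y of Vertex u \<Rightarrow> 0
          | Inner e' s \<Rightarrow> if e' = e then h y - interpolate G L (h \<circ> Vertex) y else 0)"
proof -
  let ?D = "division_points L S e"
  have L: "L e > 0" using length_pos [OF e] .
  have ends: "\<phi> 0 = h (Vertex (tail G e))" "\<phi> (L e) = h (Vertex (head G e))"
    using L by (auto simp: \<phi>_def edge_point_def)
  have tel: "(\<Sum>(s, t)\<in>consecutive ?D. if t \<le> m then \<phi> t - \<phi> s else 0) = \<phi> m - \<phi> 0"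
    if "m \<in> ?D" for m
    using division_points_bounds [OF S(2) e] that
    by (intro sum_consecutive_upto finite_division_points S(1)) (auto simp: division_points_def)
  have "(\<Sum>(s, t)\<in>consecutive ?D. \<phi> t - \<phi> s)
      = (\<Sum>(s, t)\<in>consecutive ?D. if t \<le> L e then \<phi> t - \<phi> s else 0)"
    using division_points_bounds [OF S(2) e] by (intro sum.cong) (auto simp: consecutive_def)
  also have "\<dots> = incr G (h \<circ> Vertex) e"
    by (subst tel) (auto simp: division_points_def ends incr_def)
  finally have full: "(\<Sum>(s, t)\<in>consecutive ?D. \<phi> t - \<phi> s) = incr G (h \<circ> Vertex) e" .
  have full': "(\<Sum>(s, t)\<in>consecutive ?D. c * (\<phi> t - \<phi> s)) = c * incr G (h \<circ> Vertex) e" for c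
    unfolding full [symmetric] sum_distrib_left by (intro sum.cong) auto
  have k: "k t = F (tail G e) + t / L e * incr G F e + segment_green L y e t" for t
    unfolding k_def by (rule point_green_edge_point [OF y(1) e F])
  show ?thesis
  proof (cases "\<exists>s. y = Inner e s")
    case False
    then have sg: "segment_green L y e t = 0" for t
      by (auto simp: segment_green_def split: point.splits)
    have "(\<Sum>(s, t)\<in>consecutive ?D. (k t - k s) * (\<phi> t - \<phi> s) / (t - s))
        = (\<Sum>(s, t)\<in>consecutive ?D. incr G F e / L e * (\<phi> t - \<phi> s))"
    proof (intro sum.cong refl, clarify)
      fix s t assume "(s, t) \<in> consecutive ?D"
      then have "t - s \<noteq> 0" by (auto simp: consecutive_def)
      moreover have "k t - k s = incr G F e / L e * (t - s)"
        by (simp add: k sg algebra_simps diff_divide_distrib)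
      ultimately show "(k t - k s) * (\<phi> t - \<phi> s) / (t - s) = incr G F e / L e * (\<phi> t - \<phi> s)"
        by simp
    qed
    also have "\<dots> = incr G F e * incr G (h \<circ> Vertex) e / L e" by (simp only: full') simp
    finally show ?thesis using False by (auto split: point.splits)
  next
    case True
    then obtain z where z: "y = Inner e z" by auto
    then have zD: "z \<in> ?D" and zb: "0 < z" "z < L e"
      using y by (auto simp: division_points_def points_def)
    have hz: "\<phi> z = h y" using zb by (simp add: \<phi>_def edge_point_def z)
    have "(\<Sum>(s, t)\<in>consecutive ?D. (k t - k s) * (\<phi> t - \<phi> s) / (t - s))
        = (\<Sum>(s, t)\<in>consecutive ?D. (incr G F e / L e - z / L e) * (\<phi> t - \<phi> s)
            + (if t \<le> z then \<phi> t - \<phi> s else 0))"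
    proof (intro sum.cong refl, clarify)
      fix s t assume st: "(s, t) \<in> consecutive ?D"
      then have ne: "t - s \<noteq> 0" by (auto simp: consecutive_def)
      \<comment> \<open>The pole is itself a division point, so no piece contains the kink in its
        interior.\<close>
      have "t \<le> z \<or> z \<le> s" using st zD by (auto simp: consecutive_def)
      then have "k t - k s = ((incr G F e / L e - z / L e) + (if t \<le> z then 1 else 0)) * (t - s)"
        using st by (auto simp: k segment_green_def z consecutive_def min_def algebra_simps diff_divide_distrib)
      with ne have "(k t - k s) * (\<phi> t - \<phi> s) / (t - s)
          = ((incr G F e / L e - z / L e) + (if t \<le> z then 1 else 0)) * (\<phi> t - \<phi> s)"
        by simp
      then show "(k t - k s) * (\<phi> t - \<phi> s) / (t - s)
          = (incr G F e / L e - z / L e) * (\<phi> t - \<phi> s) + (if t \<le> z then \<phi> t - \<phi> s else 0)"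
        by (simp add: distrib_right)
    qed
    also have "\<dots> = (incr G F e / L e - z / L e) * incr G (h \<circ> Vertex) e + (\<phi> z - \<phi> 0)"
      unfolding split_def sum.distrib using full' tel [OF zD] by (simp add: split_def)
    also have "\<dots> = incr G F e * incr G (h \<circ> Vertex) e / L e + (h y - interpolate G L (h \<circ> Vertex) y)"
      unfolding hz ends
      by (simp add: z interpolate_def incr_def algebra_simps diff_divide_distrib add_divide_distrib)
    finally show ?thesis by (simp add: z)
  qed
qed

text \<open>Summed over the edges, the linear parts give the value of \<open>h\<close> interpolated
  at \<open>y\<close> minus its value at \<open>p\<close>, and the correction on the edge containing
  \<open>y\<close> replaces the interpolated value by \<open>h y\<close>.\<close>

lemma subdivision_network:
  assumes S: "finite S" "S \<subseteq> points G L"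
  shows "green_network (subdivision_at G L S) segment_length (Vertex p) (point_green G L g)"
proof -
  let ?H = "subdivision_at G L S"
  have verts [simp]: "verts ?H = Vertex ` verts G \<union> S" by (simp add: subdivision_at_def)
  have node: "edge_point G L e t \<in> verts ?H" if "e \<in> arcs G" "t \<in> division_points L S e" for e t
    using that by (auto simp: edge_point_def division_points_def)
  interpret H: fin_digraph ?H
  proof
    show "finite (arcs ?H)"
      using S by (auto simp: arcs_subdivision_at intro!: finite_SigmaI finite_consecutive finite_division_points)
    show "tail ?H a \<in> verts ?H" "head ?H a \<in> verts ?H" if "a \<in> arcs ?H" for a
      using that node unfolding arcs_subdivision_at
      by (auto simp: subdivision_at_def consecutive_def simp del: verts)
  qed (use S in simp)
  show ?thesis
  proof (unfold_locales, goal_cases)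
    case (1 a)
    then show ?case by (auto simp: arcs_subdivision_at consecutive_def segment_length_def)
  next
    case 2
    then show ?case by simp
  next
    case (3 y)
    then have "y \<in> points G L" using S by (auto simp: points_def)
    then have "interpolate G L (g p) y = 0" by (auto simp: interpolate_def points_def)
    then show ?case by (simp add: point_green_def interpolate_def [of G L _ "Vertex p"])
  next
    case (4 y h)
    then have y: "y \<in> points G L" "y \<in> Vertex ` verts G \<union> S" using S by (auto simp: points_def)
    define F where "F = (\<lambda>u. interpolate G L (g u) y)"
    have "energy ?H segment_length (\<lambda>x. point_green G L g x y) h
        = (\<Sum>e\<in>arcs G. \<Sum>(s, t)\<in>consecutive (division_points L S e).
            (point_green G L g (edge_point G L e t) y - point_green G L g (edge_point G L e s) y)
            * (h (edge_point G L e t) - h (edge_point G L e s)) / (t - s))"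
      unfolding energy_def arcs_subdivision_at using S
      by (subst sum.Sigma)
        (auto simp: finite_division_points incr_def subdivision_at_def segment_length_def intro!: sum.cong)
    also have "\<dots> = (\<Sum>e\<in>arcs G. incr G F e * incr G (h \<circ> Vertex) e / L e
       + (case y of Vertex u \<Rightarrow> 0
          | Inner e' s \<Rightarrow> if e' = e then h y - interpolate G L (h \<circ> Vertex) y else 0))"
      by (intro sum.cong refl energy_segments [OF S y _ F_def])
    also have "\<dots> = energy G L F (h \<circ> Vertex) + (h y - interpolate G L (h \<circ> Vertex) y)"
      unfolding sum.distrib energy_def [symmetric] using y(1)
      by (cases y) (auto simp: points_def interpolate_def)
    also have "\<dots> = h y - h (Vertex p)"
      unfolding F_def energy_interpolate [OF y(1)] by simp
    finally show ?case .
  qed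
qed

lemma resistance_eq_point_green:
  assumes "x \<in> points G L" "y \<in> points G L"
  shows "resistance G L x y
    = point_green G L g x x + point_green G L g y y - 2 * point_green G L g x y"
proof -
  interpret H: green_network "subdivision_at G L {x, y}" segment_length "Vertex p" "point_green G L g"
    by (rule subdivision_network) (use assms in auto)
  show ?thesis
    unfolding resistance_def by (rule H.effective_resistance_eq_green) (auto simp: subdivision_at_def)
qed

end

section \<open>Integration of the squared derivative of the resistance\<close>

lemma has_integral_deriv_square:
  fixes f \<psi> \<psi>' P :: "real \<Rightarrow> real"
  assumes "l \<le> u"
    and f: "\<And>t. l < t \<Longrightarrow> t < u \<Longrightarrow> f t = \<psi> t - 2 * m * t + c"
    and \<psi>: "\<And>t. (\<psi> has_real_derivative \<psi>' t) (at t)"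
    and P: "\<And>t. (P has_real_derivative (\<psi>' t)\<^sup>2) (at t)"
  shows "((\<lambda>t. (deriv f t)\<^sup>2) has_integral
    (P u - P l - 4 * m * (\<psi> u - \<psi> l) + 4 * m\<^sup>2 * (u - l))) {l..u}"
proof -
  define Q where "Q t = P t - 4 * m * \<psi> t + 4 * m\<^sup>2 * t" for t
  have Q: "(Q has_vector_derivative (\<psi>' t - 2 * m)\<^sup>2) (at t within {l..u})" for t
  proof -
    have "(Q has_real_derivative ((\<psi>' t)\<^sup>2 - 4 * m * \<psi>' t + 4 * m\<^sup>2)) (at t)"
      unfolding Q_def [abs_def] by (auto intro!: derivative_eq_intros P \<psi>)
    also have "(\<psi>' t)\<^sup>2 - 4 * m * \<psi>' t + 4 * m\<^sup>2 = (\<psi>' t - 2 * m)\<^sup>2"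
      by (simp add: power2_eq_square algebra_simps)
    finally show ?thesis
      by (metis has_real_derivative_iff_has_vector_derivative has_vector_derivative_at_within)
  qed
  have "((\<lambda>t. (\<psi>' t - 2 * m)\<^sup>2) has_integral (Q u - Q l)) (cbox l u)"
    unfolding cbox_interval by (rule fundamental_theorem_of_calculus [OF assms(1) Q])
  \<comment> \<open>The formula for \<open>f\<close> is only available strictly between the ends,
    where \<open>f\<close> may have kinks; the two end points do not affect the integral.\<close>
  moreover have "(deriv f t)\<^sup>2 = (\<psi>' t - 2 * m)\<^sup>2" if "t \<in> box l u" for t
  proof -
    have "((\<lambda>t. \<psi> t - 2 * m * t + c) has_real_derivative (\<psi>' t - 2 * m)) (at t)"
      by (auto intro!: derivative_eq_intros \<psi>)
    then have "(f has_real_derivative (\<psi>' t - 2 * m)) (at t)"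
      by (rule has_field_derivative_transform_within_open [where S = "{l<..<u}"]) (use f that in auto)
    then show ?thesis by (simp add: DERIV_imp_deriv)
  qed
  ultimately have "((\<lambda>t. (deriv f t)\<^sup>2) has_integral (Q u - Q l)) (cbox l u)"
    by (metis (no_types, lifting) has_integral_spike_interior)
  then show ?thesis by (simp add: Q_def cbox_interval algebra_simps)
qed

context green_network
begin

text \<open>The bilinear interpolation is quadratic on the diagonal, its t^2 coefficient being the
  second difference \<open>res e\<close> of \<open>g\<close> divided by the squared length; the
  segment Green function adds t - t^2/L.\<close>

lemma point_green_diag:
  assumes e: "e \<in> arcs G" and t: "0 \<le> t" "t \<le> L e"
  shows "point_green G L g (edge_point G L e t) (edge_point G L e t)
    = diag (tail G e) + incr G diag e / L e * t + (t - t\<^sup>2 / L e) * (1 - res e / L e)"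
proof -
  let ?a = "tail G e" and ?b = "head G e" and ?x = "edge_point G L e t"
  have L: "L e > 0" using length_pos [OF e] .
  have int: "interpolate G L (g u) ?x = g u ?a + t / L e * (g u ?b - g u ?a)" for u
    by (simp add: interpolate_edge_point [OF e] incr_def)
  have seg: "segment_green L ?x e t = t - t\<^sup>2 / L e"
    using L by (auto simp: edge_point_def segment_green_def power2_eq_square)
  have "point_green G L g ?x ?x = g ?a ?a + t / L e * (g ?a ?b - g ?a ?a)
      + t / L e * ((g ?b ?a + t / L e * (g ?b ?b - g ?b ?a)) - (g ?a ?a + t / L e * (g ?a ?b - g ?a ?a)))
      + (t - t\<^sup>2 / L e)"
    unfolding point_green_edge_point [OF edge_point_in_points [OF e t] e refl] seg
    by (simp add: int incr_def algebra_simps diff_divide_distrib)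
  also have "\<dots> = diag ?a + incr G diag e / L e * t + (t - t\<^sup>2 / L e) * (1 - res e / L e)"
    using e green_commute [of ?b ?a]
    by (simp add: incr_def arc_resistance_def arc_potential_def power2_eq_square algebra_simps
        diff_divide_distrib add_divide_distrib)
  finally show ?thesis .
qed

text \<open>Along \<open>e\<close> the resistance to \<open>y\<close> is the quadratic \<psi> minus
  twice a piecewise linear function, up to a constant. If \<open>y\<close> lies inside
  \<open>e\<close>, the integral is split at its kink.\<close>

lemma arc_integral:
  assumes y: "y \<in> points G L" and e: "e \<in> arcs G" and F: "F = (\<lambda>u. interpolate G L (g u) y)"
  shows "integral {0..L e} (\<lambda>t. (deriv (\<lambda>s. resistance G L (edge_point G L e s) y) t)\<^sup>2)
    = (L e / 3 * (1 - res e / L e)\<^sup>2 + (incr G diag e)\<^sup>2 / L e)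
      - 4 * (incr G F e * incr G diag e / L e) + 4 * (incr G F e * incr G F e / L e)
      - 4 * (case y of Vertex u \<Rightarrow> 0
          | Inner e' s \<Rightarrow> if e' = e then interpolate G L F y - interpolate G L diag y else 0)"
proof -
  define l where "l = L e"
  define \<kappa> where "\<kappa> = 1 - res e / l"
  define \<delta> where "\<delta> = incr G diag e / l"
  define m where "m = incr G F e / l"
  define \<psi> where "\<psi> t = diag (tail G e) + \<delta> * t + (t - t\<^sup>2 / l) * \<kappa>" for t
  define \<psi>' where "\<psi>' t = \<delta> + (1 - 2 * t / l) * \<kappa>" for t
  define P where "P t = \<delta>\<^sup>2 * t + 2 * \<delta> * \<kappa> * (t - t\<^sup>2 / l) + \<kappa>\<^sup>2 * (t - 2 * t\<^sup>2 / l + 4 * t^3 / (3 * l\<^sup>2))" for t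
  let ?r = "\<lambda>s. resistance G L (edge_point G L e s) y"
  have l: "l > 0" using length_pos [OF e] by (simp add: l_def)
  have \<psi>_deriv: "(\<psi> has_real_derivative \<psi>' t) (at t)" for t
    unfolding \<psi>_def [abs_def] \<psi>'_def using l by (auto intro!: derivative_eq_intros simp: field_simps)
  have P_deriv: "(P has_real_derivative (\<psi>' t)\<^sup>2) (at t)" for t
    unfolding P_def [abs_def] \<psi>'_def using l
    by (auto intro!: derivative_eq_intros simp: power2_eq_square) (simp add: divide_simps, algebra)
  have P_ends: "P 0 = 0" "P l = l / 3 * \<kappa>\<^sup>2 + l * \<delta>\<^sup>2"
    using l by (simp_all add: P_def power2_eq_square power3_eq_cube algebra_simps)
  have r: "?r t = \<psi> t + point_green G L g y y - 2 * (F (tail G e) + m * t + segment_green L y e t)"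
    if "0 \<le> t" "t \<le> l" for t
    using that edge_point_in_points [OF e, of t] y
    by (simp add: resistance_eq_point_green point_green_diag [OF e] point_green_edge_point [OF y e F]
        \<psi>_def \<kappa>_def \<delta>_def m_def l_def)
  note piece = has_integral_deriv_square [where \<psi> = \<psi> and \<psi>' = \<psi>' and P = P, OF _ _ \<psi>_deriv P_deriv]
  show ?thesis
  proof (cases "\<exists>z. y = Inner e z")
    case False
    then have sg: "segment_green L y e t = 0" for t
      by (auto simp: segment_green_def split: point.splits)
    have "((\<lambda>t. (deriv ?r t)\<^sup>2) has_integral
        (P l - P 0 - 4 * m * (\<psi> l - \<psi> 0) + 4 * m\<^sup>2 * (l - 0))) {0..l}"
      by (rule piece [where c = "point_green G L g y y - 2 * F (tail G e)"])
        (use l in \<open>auto simp: r sg algebra_simps\<close>)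
    then have "integral {0..l} (\<lambda>t. (deriv ?r t)\<^sup>2)
        = P l - P 0 - 4 * m * (\<psi> l - \<psi> 0) + 4 * m\<^sup>2 * (l - 0)"
      by (rule integral_unique)
    also have "\<dots> = (l / 3 * \<kappa>\<^sup>2 + l * \<delta>\<^sup>2) - 4 * (m * (l * \<delta>)) + 4 * (m * (l * m))"
      unfolding P_ends using l by (simp add: \<psi>_def power2_eq_square)
    finally show ?thesis
      using False l by (auto simp: l_def \<kappa>_def \<delta>_def m_def power2_eq_square split: point.splits)
  next
    case True
    then obtain z where z: "y = Inner e z" by auto
    then have zb: "0 < z" "z < l" using y by (auto simp: points_def l_def)
    have sg: "segment_green L y e t = min t z - t * z / l" for t
      by (simp add: z segment_green_def l_def)
    have "((\<lambda>t. (deriv ?r t)\<^sup>2) has_integral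
        (P z - P 0 - 4 * (m + (1 - z / l)) * (\<psi> z - \<psi> 0) + 4 * (m + (1 - z / l))\<^sup>2 * (z - 0))) {0..z}"
      by (rule piece [where c = "point_green G L g y y - 2 * F (tail G e)"])
        (use zb in \<open>auto simp: r sg algebra_simps diff_divide_distrib\<close>)
    \<comment> \<open>Beyond the pole, \<open>min t z\<close> is constantly \<open>z\<close>: the
      slope drops by 1 and the constant absorbs \<open>- 2 * z\<close>.\<close>
    moreover have "((\<lambda>t. (deriv ?r t)\<^sup>2) has_integral
        (P l - P z - 4 * (m - z / l) * (\<psi> l - \<psi> z) + 4 * (m - z / l)\<^sup>2 * (l - z))) {z..l}"
      by (rule piece [where c = "point_green G L g y y - 2 * F (tail G e) - 2 * z"])
        (use zb in \<open>auto simp: r sg algebra_simps diff_divide_distrib\<close>)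
    ultimately have "((\<lambda>t. (deriv ?r t)\<^sup>2) has_integral
        ((P z - P 0 - 4 * (m + (1 - z / l)) * (\<psi> z - \<psi> 0) + 4 * (m + (1 - z / l))\<^sup>2 * (z - 0))
         + (P l - P z - 4 * (m - z / l) * (\<psi> l - \<psi> z) + 4 * (m - z / l)\<^sup>2 * (l - z)))) {0..l}"
      by (rule has_integral_combine [rotated 2]) (use zb in auto)
    then have "integral {0..l} (\<lambda>t. (deriv ?r t)\<^sup>2)
        = (P z - P 0 - 4 * (m + (1 - z / l)) * (\<psi> z - \<psi> 0) + 4 * (m + (1 - z / l))\<^sup>2 * (z - 0))
         + (P l - P z - 4 * (m - z / l) * (\<psi> l - \<psi> z) + 4 * (m - z / l)\<^sup>2 * (l - z))"
      by (rule integral_unique)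
    \<comment> \<open>The two slopes have mean \<open>m\<close> over the edge and variance (z/l)(1 -
      z/l), which accounts for the term z - z^2/l.\<close>
    also have "\<dots> = P l - P 0 - 4 * m * (\<psi> l - \<psi> 0) - 4 * (\<psi> z - (1 - z / l) * \<psi> 0 - z / l * \<psi> l)
        + 4 * m\<^sup>2 * l + 4 * (z - z\<^sup>2 / l)"
    proof -
      define w where "w = z / l"
      then have zl: "z = w * l" using l by simp
      have "z\<^sup>2 / l = w * w * l" using l by (simp add: zl power2_eq_square)
      then show ?thesis
        unfolding w_def [symmetric] unfolding zl by (simp add: power2_eq_square algebra_simps)
    qed
    also have "\<dots> = (l / 3 * \<kappa>\<^sup>2 + l * \<delta>\<^sup>2) - 4 * (m * (l * \<delta>)) + 4 * (m * (l * m))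
       - 4 * (\<psi> z - (z - z\<^sup>2 / l) - (1 - z / l) * \<psi> 0 - z / l * \<psi> l)"
      unfolding P_ends using l by (simp add: \<psi>_def [of 0] \<psi>_def [of l] power2_eq_square algebra_simps)
    \<comment> \<open>\<psi> at z is the value of the extended Green function at (y, y); removing
      its segment part leaves the interpolation.\<close>
    also have "\<psi> z - (z - z\<^sup>2 / l) = interpolate G L F y"
    proof -
      have ep: "edge_point G L e z = y" using zb by (simp add: edge_point_def z l_def)
      have "\<psi> z = point_green G L g y y"
        using point_green_diag [OF e, of z] zb by (simp add: ep \<psi>_def \<kappa>_def \<delta>_def l_def)
      then show ?thesis
        by (simp add: point_green_def F z segment_green_def l_def power2_eq_square)
    qed
    also have "\<psi> 0 = diag (tail G e)" by (simp add: \<psi>_def)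
    also have "\<psi> l = diag (head G e)" using l by (simp add: \<psi>_def power2_eq_square \<delta>_def incr_def)
    finally show ?thesis
      using l by (simp add: l_def \<kappa>_def \<delta>_def m_def power2_eq_square z interpolate_def [of G L diag])
  qed
qed

text \<open>
  The terms depending on the base point \<open>y\<close> cancel, because both pairings of \<open>g(\<cdot>, y)\<close> with
  itself and with the diagonal of \<open>g\<close> evaluate to \<open>g(y, y)\<close>.
\<close>

lemma tau_eq:
  assumes y: "y \<in> points G L"
  shows "tau G L y = 1/4 * (\<Sum>e\<in>arcs G. L e / 3 * (1 - res e / L e)\<^sup>2 + (incr G diag e)\<^sup>2 / L e)"
proof -
  define F where "F = (\<lambda>u. interpolate G L (g u) y)"
  define X where "X = interpolate G L F y - interpolate G L diag y"
  let ?A = "\<lambda>e. L e / 3 * (1 - res e / L e)\<^sup>2 + (incr G diag e)\<^sup>2 / L e"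
  let ?X = "\<lambda>e. case y of Vertex u \<Rightarrow> 0 | Inner e' s \<Rightarrow> if e' = e then X else 0"
  have Fp: "F p = 0" using y by (auto simp: F_def interpolate_def points_def)
  have "(\<Sum>e\<in>arcs G. integral {0..L e} (\<lambda>t. (deriv (\<lambda>s. resistance G L (edge_point G L e s) y) t)\<^sup>2))
      = (\<Sum>e\<in>arcs G. ?A e - 4 * (incr G F e * incr G diag e / L e)
          + 4 * (incr G F e * incr G F e / L e) - 4 * ?X e)"
    unfolding X_def by (intro sum.cong refl arc_integral [OF y _ F_def])
  also have "\<dots> = (\<Sum>e\<in>arcs G. ?A e) - 4 * energy G L F diag + 4 * energy G L F F - 4 * (\<Sum>e\<in>arcs G. ?X e)"
    unfolding energy_def sum_subtractf sum.distrib sum_distrib_left [symmetric] ..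
  also have "(\<Sum>e\<in>arcs G. ?X e) = X"
    using y by (cases y) (auto simp: points_def X_def interpolate_def F_def)
  also have "energy G L F diag = interpolate G L diag y"
    unfolding F_def energy_interpolate [OF y] by simp
  also have "energy G L F F = interpolate G L F y"
    using energy_interpolate [OF y, of F] Fp by (simp add: F_def)
  finally show ?thesis by (simp add: tau_def X_def)
qed

end

section \<open>The tau formula and the inequalities for x and y\<close>

theorem theorem6p9:
  fixes G :: "('v, 'e) pre_digraph" and L :: "'e \<Rightarrow> real" and p :: 'v
    and v :: nat and x y :: real
  assumes "metrized_graph G L"
    and "normalized G L"
    and "bridgeless G"
    and "p \<in> verts G"
  defines "v \<equiv> card (verts G)"
    and "x \<equiv> x_invariant G L p"
    and "y \<equiv> y_invariant G L p"
  shows "(\<forall>q\<in>points G L. tau G L q = 1/12 - x/6 + y/6)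
    \<and> (1 \<ge> (real (edge_connectivity G) + real v - 1) / (real v - 1) * x + y \<and> x \<ge> 0 \<and> y \<ge> 0)
    \<and> y \<ge> (real v + 6) / (4 * real v) * (x + y)\<^sup>2
    \<and> (of_int (genus G) * y \<ge> x \<and> x \<ge> (real (edge_connectivity G) - 1) * y)"
proof -
  interpret metrized_graph G L by fact
  have conn: "Digraph_Component.connected G" by (rule connected_graph)
  obtain g where "green_network G L p g"
    using exists_green_network [OF conn _ assms(4), of L] length_pos by auto
  then interpret green_network G L p g .
  have del: "Digraph_Component.connected (del_arc e)" if "e \<in> arcs G" for e
    using assms(3) that by (simp add: bridgeless_def)
  have total: "(\<Sum>e\<in>arcs G. L e) = 1"
    using assms(2) by (simp add: normalized_def total_length_def)
  define R where "R = (\<Sum>e\<in>arcs G. res e)"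
  have y: "y = (\<Sum>e\<in>arcs G. arc_moment G g e / L e)"
    unfolding y_def by (rule y_invariant_eq [OF del])
  have x: "x = R - y"
    unfolding x_def y R_def by (rule x_invariant_eq [OF del])
  have v: "v > 0" unfolding v_def by (rule card_verts_pos)
  have y_nonneg: "y \<ge> 0"
    unfolding y using length_pos by (auto intro!: sum_nonneg divide_nonneg_pos arc_moment_nonneg)

  have "tau G L q = 1/12 - x/6 + y/6" if "q \<in> points G L" for q
  proof -
    let ?C = "\<Sum>e\<in>arcs G. (res e)\<^sup>2 / L e" and ?D = "\<Sum>e\<in>arcs G. (incr G diag e)\<^sup>2 / L e"
    have "L e / 3 * (1 - res e / L e)\<^sup>2 = 1/3 * L e - 2/3 * res e + 1/3 * ((res e)\<^sup>2 / L e)"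
      if "e \<in> arcs G" for e
      using length_pos [OF that] by (simp add: power2_eq_square field_simps)
    then have "(\<Sum>e\<in>arcs G. L e / 3 * (1 - res e / L e)\<^sup>2 + (incr G diag e)\<^sup>2 / L e)
        = (\<Sum>e\<in>arcs G. 1/3 * L e - 2/3 * res e + 1/3 * ((res e)\<^sup>2 / L e) + (incr G diag e)\<^sup>2 / L e)"
      by (intro sum.cong) auto
    then have "tau G L q = 1/4 * (\<Sum>e\<in>arcs G. 1/3 * L e - 2/3 * res e + 1/3 * ((res e)\<^sup>2 / L e)
        + (incr G diag e)\<^sup>2 / L e)"
      by (simp only: tau_eq [OF that])
    also have "\<dots> = 1/4 * (1/3 - 2/3 * R + 1/3 * ?C + ?D)"
      unfolding sum.distrib sum_subtractf sum_distrib_left [symmetric] total R_def by simp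
    finally have tau: "tau G L q = 1/4 * (1/3 - 2/3 * R + 1/3 * ?C + ?D)" .
    \<comment> \<open>The two quadratic sums enter tau only through ?C/12 + ?D/4, which is
      y/3.\<close>
    have "4 * y = ?C + 3 * ?D"
      unfolding y sum_distrib_left sum.distrib [symmetric]
      by (intro sum.cong refl) (simp add: four_arc_moment add_divide_distrib)
    moreover have "1/4 * (1/3 - 2/3 * R + 1/3 * c + d) = 1/12 - (R - y)/6 + y/6"
      if "4 * y = c + 3 * d" for c d :: real
      using that by (simp add: field_simps)
    ultimately show ?thesis unfolding tau x by blast
  qed
  moreover have "(real (edge_connectivity G) + real v - 1) / (real v - 1) * x + y \<le> 1 \<and> x \<ge> 0
      \<and> of_int (genus G) * y \<ge> x \<and> x \<ge> (real (edge_connectivity G) - 1) * y"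
  proof (cases "v = 1")
    \<comment> \<open>With a single vertex all arcs are loops, so x = y = 0, and the quotient with
      denominator 0 is 0 by convention.\<close>
    case True
    then have "tail G e = head G e" if "e \<in> arcs G" for e
      using that unfolding v_def by (metis card_1_singletonE head_in_verts singletonD tail_in_verts)
    then have "R = 0" "y = 0" by (simp_all add: R_def y loop_res loop_moment)
    then show ?thesis by (simp add: x)
  next
    case False
    with v have v2: "real v - 1 > 0" by simp
    have cut: "real (edge_connectivity G) \<le> real (card {e \<in> arcs G. (tail G e \<in> S) \<noteq> (head G e \<in> S)})"
        "1 \<le> real (card {e \<in> arcs G. (tail G e \<in> S) \<noteq> (head G e \<in> S)})"
      if "S \<subseteq> verts G" "S \<noteq> {}" "S \<noteq> verts G" for S
      using cut_card [OF conn that] by simp_all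
    note bounds = network_bounds [OF green_network_axioms, folded R_def y v_def, unfolded total]
    \<comment> \<open>By connectedness every cut contains an arc, so the bounds also hold with k =
      1, which gives nonnegativity of x.\<close>
    have "R \<ge> y" using bounds [of 1] cut(2) by simp
    moreover have b: "real (edge_connectivity G) * y \<le> R"
        "R \<le> (real (card (arcs G)) - real v + 2) * y"
        "real (edge_connectivity G) * (R - y) \<le> (real v - 1) * (1 - R)"
      using bounds [of "real (edge_connectivity G)"] cut(1) by blast+
    \<comment> \<open>Since x + y = R, splitting off the summand 1 of the coefficient turns the
      claim into the third bound.\<close>
    moreover have "(real (edge_connectivity G) + real v - 1) / (real v - 1) * x
        = real (edge_connectivity G) * x / (real v - 1) + x"
      using v2 by (simp add: field_simps)
    moreover have "real (edge_connectivity G) * x / (real v - 1) \<le> 1 - R"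
      using b(3) v2 by (simp add: x divide_le_eq mult.commute)
    \<comment> \<open>The factor in the second bound is genus + 1, and subtracting y from both sides
      leaves x on the left.\<close>
    moreover have "of_int (genus G) * y = (real (card (arcs G)) - real v + 2) * y - y"
      by (simp add: genus_def v_def algebra_simps)
    ultimately show ?thesis by (simp add: x algebra_simps)
  qed
  moreover have "y \<ge> (real v + 6) / (4 * real v) * (x + y)\<^sup>2"
    using moment_bound by (simp add: total x R_def y v_def)
  ultimately show ?thesis using y_nonneg by blast
qed

end
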